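(* (1) $T'\circ LT'\subseteq T'$. (2) $DT'\circ T'\subseteq T'$ and $DT'\circ DT'\subseteq DT'$. Here $T'$, $LT'$, $DT'$ denote the classes of top-down, linear top-down, and deterministic top-down tree transformations with regular look-ahead, and in $F\circ G$ the transformation from $F$ is applied first.
   Context: Alphabets are finite. A ranked alphabet $\Sigma$ is a finite set of symbols with, for each $k\ge 0$, a subset $\Sigma_k$ (symbols of rank $k$; a symbol may have several ranks), $\Sigma=\bigcup_k\Sigma_k$, only finitely many $\Sigma_k$ nonempty. $T_\Sigma$ is the set of trees over $\Sigma$: $a\in T_\Sigma$ for $a\in\Sigma_0$, and $a[t_1\cdots t_k]\in T_\Sigma$ for $k\ge1$, $a\in\Sigma_k$, $t_i\in T_\Sigma$. For a set $S$ of trees or of new symbols (regarded as having rank $0$), $T_\Sigma(S)$ is the smallest set containing $S\cup\Sigma_0$ and closed under $(t_1,\dots,t_k)\mapsto a[t_1\cdots t_k]$ for $k\ge1$, $a\in\Sigma_k$. A tree transformation from $T_\Sigma$ into $T_\Delta$ is a subset of $T_\Sigma\times T_\Delta$. $M_1\circ M_2=\{(s,t)\mid (s,u)\in M_1,(u,t)\in M_2\text{ for some }u\in T_\Delta\}$ for $M_1\subseteq T_\Sigma\times T_\Delta$, $M_2\subseteq T_\Delta\times T_\Omega$; $F\circ G=\{M_1\circ M_2\mid M_1\in F,M_2\in G\}$. Variables: $X_k=\{x_1,\dots,x_k\}$. $L\subseteq T_\Sigma$ is recognizable if $L=\{t\in T_\Sigma\mid\widehat\delta(t)\in F\}$ for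 some finite set $Q$, $F\subseteq Q$, $s_a\in Q$ ($a\in\Sigma_0$), $\delta_a^k:Q^k\to Q$ ($k\ge1,a\in\Sigma_k$), where $\widehat\delta(a)=s_a$, $\widehat\delta(a[t_1\cdots t_k])=\delta_a^k(\widehat\delta(t_1),\dots,\widehat\delta(t_k))$. A top-down finite tree transducer with regular look-ahead is $M=(Q,\Sigma,\Delta,R,Q_d)$, where $Q$ is a finite set of states, regarded as symbols of rank $1$ only and disjoint from $\Sigma\cup\Delta$, $Q_d\subseteq Q$ (initial states), and $R$ is a finite set of rules $(v\to w,D)$, where $v\to w$ has the form $q[a[x_1\cdots x_k]]\to t$ ($k\ge1$, $a\in\Sigma_k$, $q\in Q$, $t\in T_\Delta(Q[X_k])$, $Q[X_k]=\{q[x]\mid q\in Q,x\in X_k\}$) or $q[a]\to t$ ($a\in\Sigma_0$, $q\in Q$, $t\in T_\Delta$), and $D$ assigns to each $x_i$, $1\le i\le k$, a recognizable range $D(x_i)\subseteq T_\Sigma$. Rules rewrite trees over $Q\cup\Sigma\cup\Delta$: $s\Rightarrow s'$ if $s'$ arises from $s$ by replacing one occurrence of a subtree $v\langle x_1\gets\phi_1,\dots,x_k\gets\phi_k\rangle$ by $w\langle x_1\gets\phi_1,\dots,x_k\gets\phi_k\rangle$ for a rule $(v\to w,D)$ and some $\phi_i\in D(x_i)$ (simultaneous substitution). $M$ realizes $\{(s,t)\in T_\Sigma\times T_\Delta\mid q[s]\Rightarrow^*t\text{ for some }q\in Q_d\}$. $M$ is linear (letter $L$) if no variable occurs more than once in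 the right hand side of a rule; $M$ is (partial) deterministic (letter $D$) if $Q_d$ is a singleton and for any two different rules $(s\to t_1,D_1),(s\to t_2,D_2)$ with the same left hand side, $D_1(x_i)\cap D_2(x_i)=\emptyset$ for some $i$, $1\le i\le k$, $k$ being the number of variables in $s$. $T'$, $LT'$, $DT'$ are the classes of tree transformations realized by arbitrary, linear, deterministic top-down finite tree transducers with regular look-ahead. *)

theory Defs
  imports Main
begin

section \<open>Trees over ranked alphabets\<close>

text \<open>The tree consisting of the single symbol \<open>a\<close> is \<open>Node a []\<close>.\<close>

datatype 'a tree = Node 'a "'a tree list"

text \<open>\<open>\<Sigma> k\<close> is the set of symbols of rank \<open>k\<close>; a symbol may have several ranks.\<close>

type_synonym 'a ranked = "nat \<Rightarrow> 'a set"

definition ranked_alphabet :: "'a ranked \<Rightarrow> bool" where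
  "ranked_alphabet \<Sigma> \<longleftrightarrow> finite (\<Union>k. \<Sigma> k) \<and> finite {k. \<Sigma> k \<noteq> {}}"

inductive_set trees_over :: "'a ranked \<Rightarrow> 'a tree set \<Rightarrow> 'a tree set"
  for \<Sigma> :: "'a ranked" and S :: "'a tree set"
where
  base: "t \<in> S \<Longrightarrow> t \<in> trees_over \<Sigma> S"
| leaf: "a \<in> \<Sigma> 0 \<Longrightarrow> Node a [] \<in> trees_over \<Sigma> S"
| node: "1 \<le> length ts \<Longrightarrow> a \<in> \<Sigma> (length ts) \<Longrightarrow> (\<And>t. t \<in> set ts \<Longrightarrow> t \<in> trees_over \<Sigma> S)
    \<Longrightarrow> Node a ts \<in> trees_over \<Sigma> S"

abbreviation trees :: "'a ranked \<Rightarrow> 'a tree set" where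
  "trees \<Sigma> \<equiv> trees_over \<Sigma> {}"

type_synonym 'a transformation = "('a tree \<times> 'a tree) set"

definition class_comp ::
    "'a transformation set \<Rightarrow> 'a transformation set \<Rightarrow> 'a transformation set" (infixl "\<circ>\<^sub>c" 75) where
  "F \<circ>\<^sub>c G = {M\<^sub>1 O M\<^sub>2 | M\<^sub>1 M\<^sub>2. M\<^sub>1 \<in> F \<and> M\<^sub>2 \<in> G}"


section \<open>Recognizable tree languages\<close>

text \<open>\<open>s a\<close> is the state assigned to a leaf \<open>a\<close>, and \<open>\<delta> k a\<close> is the transition function for \<open>a\<close>
  as a symbol of rank \<open>k\<close>, applied to lists of length \<open>k\<close>.\<close>

fun run :: "('a \<Rightarrow> 'q) \<Rightarrow> (nat \<Rightarrow> 'a \<Rightarrow> 'q list \<Rightarrow> 'q) \<Rightarrow> 'a tree \<Rightarrow> 'q" where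
  "run s \<delta> (Node a ts) = (if ts = [] then s a else \<delta> (length ts) a (map (run s \<delta>) ts))"

definition automaton ::
    "'a ranked \<Rightarrow> 'q set \<Rightarrow> 'q set \<Rightarrow> ('a \<Rightarrow> 'q) \<Rightarrow> (nat \<Rightarrow> 'a \<Rightarrow> 'q list \<Rightarrow> 'q) \<Rightarrow> bool" where
  "automaton \<Sigma> Q F s \<delta> \<longleftrightarrow>
     finite Q \<and> F \<subseteq> Q \<and> (\<forall>a \<in> \<Sigma> 0. s a \<in> Q) \<and>
     (\<forall>k \<ge> 1. \<forall>a \<in> \<Sigma> k. \<forall>qs. length qs = k \<and> set qs \<subseteq> Q \<longrightarrow> \<delta> k a qs \<in> Q)"

text \<open>Since state sets are finite, taking states from \<open>nat\<close> loses no generality; the same applies to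
  the transducers below.\<close>

definition recognizable :: "'a ranked \<Rightarrow> 'a tree set \<Rightarrow> bool" where
  "recognizable \<Sigma> L \<longleftrightarrow>
     (\<exists>(Q :: nat set) F s \<delta>. automaton \<Sigma> Q F s \<delta> \<and> L = {t \<in> trees \<Sigma>. run s \<delta> t \<in> F})"


section \<open>Top-down tree transducers with regular look-ahead\<close>

text \<open>The disjoint union keeps states and variables apart from the input and output symbols, which
  share one type and may overlap. Variables are numbered from \<open>0\<close>: \<open>Var i\<close> stands for $x_{i+1}$.\<close>

datatype ('a, 'q) sym = Sym 'a | State 'q | Var nat

abbreviation embed :: "'a tree \<Rightarrow> ('a, 'q) sym tree" where
  "embed \<equiv> map_tree Sym"

abbreviation embed_ranked :: "'a ranked \<Rightarrow> ('a, 'q) sym ranked" where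
  "embed_ranked \<Sigma> \<equiv> \<lambda>k. Sym ` \<Sigma> k"

abbreviation var :: "nat \<Rightarrow> ('a, 'q) sym tree" where
  "var i \<equiv> Node (Var i) []"

fun subst :: "(nat \<Rightarrow> ('a, 'q) sym tree) \<Rightarrow> ('a, 'q) sym tree \<Rightarrow> ('a, 'q) sym tree" where
  "subst \<sigma> (Node (Var i) ts) = \<sigma> i"
| "subst \<sigma> (Node (Sym a) ts) = Node (Sym a) (map (subst \<sigma>) ts)"
| "subst \<sigma> (Node (State q) ts) = Node (State q) (map (subst \<sigma>) ts)"

text \<open>\<open>Rule q a D t\<close> is the rule $(q[a[x_1 \cdots x_k]] \to t, D)$, where \<open>k = length D\<close> and
  \<open>D ! i\<close> is the range of \<open>Var i\<close>.\<close>

datatype ('a, 'q) rule =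
  Rule (rule_state: 'q) (rule_sym: 'a) (ranges: "'a tree set list") (rhs: "('a, 'q) sym tree")

definition lhs :: "('a, 'q) rule \<Rightarrow> ('a, 'q) sym tree" where
  "lhs r = Node (State (rule_state r)) [Node (Sym (rule_sym r)) (map var [0..<length (ranges r)])]"

record ('a, 'q) transducer =
  states :: "'q set"
  inputs :: "'a ranked"
  outputs :: "'a ranked"
  rules :: "('a, 'q) rule set"
  initial :: "'q set"

text \<open>For \<open>k = 0\<close> the right-hand side is required to be in \<open>trees (outputs M)\<close>, as there are no
  variables.\<close>

definition rule_of :: "('a, 'q) transducer \<Rightarrow> ('a, 'q) rule \<Rightarrow> bool" where
  "rule_of M r \<longleftrightarrow> (let k = length (ranges r) in
     rule_state r \<in> states M \<and> rule_sym r \<in> inputs M k \<and>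
     (\<forall>L \<in> set (ranges r). recognizable (inputs M) L) \<and>
     rhs r \<in> trees_over (embed_ranked (outputs M))
                {Node (State q) [var i] | q i. q \<in> states M \<and> i < k})"

definition transducer :: "('a, 'q) transducer \<Rightarrow> bool" where
  "transducer M \<longleftrightarrow>
     finite (states M) \<and> ranked_alphabet (inputs M) \<and> ranked_alphabet (outputs M) \<and>
     finite (rules M) \<and> (\<forall>r \<in> rules M. rule_of M r) \<and> initial M \<subseteq> states M"

inductive step :: "('a, 'q) rule set \<Rightarrow> ('a, 'q) sym tree \<Rightarrow> ('a, 'q) sym tree \<Rightarrow> bool"
  for R :: "('a, 'q) rule set"
where
  apply_rule: "r \<in> R \<Longrightarrow> (\<And>i. i < length (ranges r) \<Longrightarrow> \<phi> i \<in> ranges r ! i)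
    \<Longrightarrow> step R (subst (\<lambda>i. embed (\<phi> i)) (lhs r)) (subst (\<lambda>i. embed (\<phi> i)) (rhs r))"
| in_context: "step R t t' \<Longrightarrow> step R (Node x (us @ t # vs)) (Node x (us @ t' # vs))"

definition realized :: "('a, 'q) transducer \<Rightarrow> 'a transformation" where
  "realized M = {(s, t). s \<in> trees (inputs M) \<and> t \<in> trees (outputs M) \<and>
     (\<exists>q \<in> initial M. (step (rules M))\<^sup>*\<^sup>* (Node (State q) [embed s]) (embed t))}"

fun symbols :: "'a tree \<Rightarrow> 'a list" where
  "symbols (Node a ts) = a # concat (map symbols ts)"

definition linear :: "('a, 'q) transducer \<Rightarrow> bool" where
  "linear M \<longleftrightarrow> (\<forall>r \<in> rules M. \<forall>i. count_list (symbols (rhs r)) (Var i) \<le> 1)"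

definition deterministic :: "('a, 'q) transducer \<Rightarrow> bool" where
  "deterministic M \<longleftrightarrow>
     (\<exists>q. initial M = {q}) \<and>
     (\<forall>r\<^sub>1 \<in> rules M. \<forall>r\<^sub>2 \<in> rules M. r\<^sub>1 \<noteq> r\<^sub>2 \<and> lhs r\<^sub>1 = lhs r\<^sub>2 \<longrightarrow>
        (\<exists>i < length (ranges r\<^sub>1). ranges r\<^sub>1 ! i \<inter> ranges r\<^sub>2 ! i = {}))"

definition T' :: "'a transformation set" where
  "T' = {realized M | M :: ('a, nat) transducer. transducer M}"

definition LT' :: "'a transformation set" where
  "LT' = {realized M | M :: ('a, nat) transducer. transducer M \<and> linear M}"

definition DT' :: "'a transformation set" where
  "DT' = {realized M | M :: ('a, nat) transducer. transducer M \<and> deterministic M}"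

end

theory Submission imports Defs "HOL-Library.Countable" begin

text \<open>The composite runs \<open>M\<^sub>2\<close> on the right-hand sides of the rules of \<open>M\<^sub>1\<close>. The look-ahead of \<open>M\<^sub>2\<close>
  concerns output trees of \<open>M\<^sub>1\<close>. It is evaluated through a finite congruence \<open>h\<^sub>2\<close> saturating all ranges
  of \<open>M\<^sub>2\<close>: for an input subtree \<open>s\<close>, the pairs \<open>(q, v)\<close> such that \<open>M\<^sub>1\<close> can translate \<open>s\<close> from \<open>q\<close> to
  a tree with \<open>h\<^sub>2\<close>-value \<open>v\<close> again form a finite congruence, hence are available to the regular
  look-ahead of the composite. The look-ahead of \<open>M\<^sub>2\<close> and its translations must refer to the same
  output tree of \<open>M\<^sub>1\<close>. This is automatic if \<open>M\<^sub>1\<close> is deterministic. If \<open>M\<^sub>2\<close> is linear, at most one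
  translation starts at each subtree, and the look-ahead value assumed for it is passed on in the
  state.\<close>


section \<open>Interpretation of right-hand sides\<close>

text \<open>Function symbols are read as \<open>f\<close>, and a leaf \<open>q[x\<^sub>i]\<close> takes any value \<open>x\<close> with \<open>V q i x\<close>,
  chosen independently at each occurrence.\<close>

inductive interp ::
    "('a \<Rightarrow> 'b list \<Rightarrow> 'b) \<Rightarrow> ('q \<Rightarrow> nat \<Rightarrow> 'b \<Rightarrow> bool) \<Rightarrow> ('a, 'q) sym tree \<Rightarrow> 'b \<Rightarrow> bool"
  for f V
where
  State: "V q i x \<Longrightarrow> interp f V (Node (State q) [var i]) x"
| Sym: "list_all2 (interp f V) ws xs \<Longrightarrow> interp f V (Node (Sym a) ws) (f a xs)"
monos list.rel_mono

inductive_simps interp_State_iff: "interp f V (Node (State q) ws) x"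
inductive_simps interp_Sym_iff: "interp f V (Node (Sym a) ws) x"
inductive_simps interp_Var_iff: "interp f V (Node (Var i) ws) x"

lemmas interp_simps [simp] = interp_State_iff interp_Sym_iff interp_Var_iff

lemma interp_mono:
  assumes "interp f V w x" and "\<And>q i x. Var i \<in> set (symbols w) \<Longrightarrow> V q i x \<Longrightarrow> V' q i x"
  shows "interp f V' w x"
  using assms
proof (induction rule: interp.induct)
  case (Sym ws xs a)
  have "list_all2 (interp f V') ws xs"
    using Sym.IH by (rule list.rel_mono_strong) (use Sym.prems in auto)
  then show ?case by (rule interp.Sym)
qed auto

text \<open>Two valuations are compared because, in an induction, one of them also carries the
  induction hypothesis.\<close>

lemma interp_functional:
  assumes "interp f V w x" and "interp f V' w y"
    and "\<And>q i x y. V q i x \<Longrightarrow> V' q i y \<Longrightarrow> x = y"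
  shows "x = y"
  using assms(1,2)
proof (induction arbitrary: y rule: interp.induct)
  case (State q i x)
  then show ?case using assms(3) by auto
next
  case (Sym ws xs a)
  then show ?case
    by (auto simp: list_all2_conv_all_nth intro!: arg_cong[where f = "f a"] nth_equalityI)
qed

lemma finite_list_all2:
  assumes "\<And>w. w \<in> set ws \<Longrightarrow> finite {x. P w x}"
  shows "finite {xs. list_all2 P ws xs}"
  using assms
proof (induction ws)
  case (Cons w ws)
  have "{xs. list_all2 P (w # ws) xs} = (\<lambda>(x, xs). x # xs) ` ({x. P w x} \<times> {xs. list_all2 P ws xs})"
    by (auto simp: list_all2_Cons1)
  with Cons show ?case by simp
next
  case Nil
  have "{xs. list_all2 P [] xs} = {[]}" by auto
  then show ?case by simp
qed

lemma finite_interp: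
  assumes "\<And>q i. finite {x. V q i x}"
  shows "finite {x. interp f V w x}"
proof (induction w)
  case (Node s ws)
  show ?case
  proof (cases s)
    case (Sym a)
    have "{x. interp f V (Node s ws) x} = f a ` {xs. list_all2 (interp f V) ws xs}"
      using Sym by auto
    with finite_list_all2[of ws "interp f V"] Node show ?thesis by simp
  next
    case (State q)
    show ?thesis
    proof (cases "\<exists>i. ws = [var i]")
      case True
      then show ?thesis using State assms by auto
    qed (use State in auto)
  qed auto
qed

lemma list_all2_relcompp_choice:
  "list_all2 (\<lambda>x z. \<exists>y. P x y \<and> Q y z) xs zs \<longleftrightarrow> (\<exists>ys. list_all2 P xs ys \<and> list_all2 Q ys zs)"
  using list.rel_compp[of P Q] by (auto simp: fun_eq_iff OO_def)

lemma list_all2_cong_left: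
  assumes "\<And>x y. x \<in> set xs \<Longrightarrow> P x y \<longleftrightarrow> Q x y"
  shows "list_all2 P xs ys \<longleftrightarrow> list_all2 Q xs ys"
  using assms by (metis list.rel_cong)

lemma list_all2_eq_map: "list_all2 (\<lambda>x y. y = h x) xs ys \<longleftrightarrow> ys = map h xs"
  by (auto simp: list_all2_conv_all_nth intro!: nth_equalityI)

text \<open>Choices at the leaves are independent, so values \<open>h u\<close> chosen leaf by leaf
  come from trees \<open>u\<close> chosen leaf by leaf. With \<open>h\<^sub>2\<close> as
  \<open>h\<close>, look-ahead values of outputs can be computed on right-hand sides.\<close>

lemma interp_fusion:
  assumes hom: "\<And>a us. h (Node a us) = f a (map h us)"
  shows "interp f (\<lambda>q i x. \<exists>u. V q i u \<and> x = h u) w x \<longleftrightarrow> (\<exists>u. interp Node V w u \<and> x = h u)"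
proof (induction w arbitrary: x)
  case (Node s ws)
  show ?case
  proof (cases s)
    case (Sym a)
    have "list_all2 (interp f (\<lambda>q i x. \<exists>u. V q i u \<and> x = h u)) ws xs \<longleftrightarrow>
      (\<exists>us. list_all2 (interp Node V) ws us \<and> xs = map h us)" for xs
      unfolding list_all2_eq_map[symmetric] list_all2_relcompp_choice[symmetric]
      by (rule list_all2_cong_left) (rule Node)
    then show ?thesis using Sym by (auto simp: hom)
  qed auto
qed

text \<open>Independence of the choices lets substitution at the leaves and evaluation merge into
  one pass. Right-hand sides of the composite arise by such substitutions into right-hand sides of
  the second transducer.\<close>

lemma interp_assoc:
  "interp f (\<lambda>p i x. \<exists>t. W p i t \<and> interp f V t x) z x \<longleftrightarrow>
    (\<exists>t. interp (\<lambda>a. Node (Sym a)) W z t \<and> interp f V t x)"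
proof (induction z arbitrary: x)
  case (Node s zs)
  show ?case
  proof (cases s)
    case (Sym a)
    have "list_all2 (interp f (\<lambda>p i x. \<exists>t. W p i t \<and> interp f V t x)) zs xs \<longleftrightarrow>
      (\<exists>ts. list_all2 (interp (\<lambda>a. Node (Sym a)) W) zs ts \<and> list_all2 (interp f V) ts xs)" for xs
      unfolding list_all2_relcompp_choice[symmetric] by (rule list_all2_cong_left) (rule Node)
    then have "interp f (\<lambda>p i x. \<exists>t. W p i t \<and> interp f V t x) (Node s zs) x \<longleftrightarrow>
      (\<exists>ts xs. list_all2 (interp (\<lambda>a. Node (Sym a)) W) zs ts \<and> list_all2 (interp f V) ts xs \<and> x = f a xs)"
      using Sym by (simp only: interp_Sym_iff) blast
    also have "\<dots> \<longleftrightarrow> (\<exists>t. interp (\<lambda>a. Node (Sym a)) W (Node s zs) t \<and> interp f V t x)"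
      using Sym by (simp only: interp_Sym_iff) (metis interp_Sym_iff)
    finally show ?thesis .
  qed auto
qed

text \<open>In a linear right-hand side every variable is used at most once, so the witnesses chosen at
  the leaves can be collected into one witness per variable.\<close>

lemma interp_linear_choice:
  assumes "interp f (\<lambda>p i x. \<exists>u. P i u \<and> Q p i u x) z x"
    and "\<And>i. count_list (symbols z) (Var i) \<le> 1"
    and total: "\<And>i. i \<in> I \<Longrightarrow> \<exists>u. P i u"
  shows "\<exists>U. (\<forall>i\<in>I. P i (U i)) \<and> interp f (\<lambda>p i x. Q p i (U i) x) z x"
  using assms(1,2)
proof (induction rule: interp.induct)
  case (State q i x)
  then obtain u where "P i u" "Q q i u x" by auto
  moreover obtain U where "\<forall>i\<in>I. P i (U i)" using total by metis
  ultimately show ?case by (intro exI[of _ "U(i := u)"]) auto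
next
  case (Sym ws xs a)
  have "\<exists>U. (\<forall>i\<in>I. P i (U i)) \<and> list_all2 (interp f (\<lambda>p i x. Q p i (U i) x)) ws xs"
    if "\<And>i. count_list (concat (map symbols ws)) (Var i) \<le> 1"
    using Sym.IH that
  proof (induction rule: list_all2_induct)
    case Nil
    then show ?case using total by (simp; metis)
  next
    case (Cons w ws x xs)
    have lin: "count_list (symbols w) (Var i) + count_list (concat (map symbols ws)) (Var i) \<le> 1" for i
      using Cons.prems(1)[of i] by simp
    have "\<exists>U. (\<forall>i\<in>I. P i (U i)) \<and> interp f (\<lambda>p i x. Q p i (U i) x) w x"
      using Cons.hyps(1) lin by (auto intro: add_leD1)
    then obtain U where U: "\<forall>i\<in>I. P i (U i)" "interp f (\<lambda>p i x. Q p i (U i) x) w x"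
      by blast
    have "\<exists>U. (\<forall>i\<in>I. P i (U i)) \<and> list_all2 (interp f (\<lambda>p i x. Q p i (U i) x)) ws xs"
      using Cons.IH lin by (auto intro: add_leD2)
    then obtain U' where U': "\<forall>i\<in>I. P i (U' i)"
      "list_all2 (interp f (\<lambda>p i x. Q p i (U' i) x)) ws xs"
      by blast
    have disj: "Var i \<notin> set (symbols w)" if "Var i \<in> set (concat (map symbols ws))" for i
    proof
      assume "Var i \<in> set (symbols w)"
      then have "count_list (symbols w) (Var i) \<noteq> 0" by (simp add: count_list_0_iff)
      moreover have "count_list (concat (map symbols ws)) (Var i) \<noteq> 0"
        using that by (simp only: count_list_0_iff not_not)
      ultimately show False using lin[of i] by linarith
    qed
    let ?U = "\<lambda>i. if Var i \<in> set (symbols w) then U i else U' i"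
    have "interp f (\<lambda>p i x. Q p i (?U i) x) w x"
      using U(2) by (rule interp_mono) simp
    moreover have "list_all2 (interp f (\<lambda>p i x. Q p i (?U i) x)) ws xs"
      using U'(2)
    proof (rule list.rel_mono_strong)
      fix v y assume "v \<in> set ws" "interp f (\<lambda>p i x. Q p i (U' i) x) v y"
      from this(2) show "interp f (\<lambda>p i x. Q p i (?U i) x) v y"
        by (rule interp_mono) (use \<open>v \<in> set ws\<close> disj in auto)
    qed
    moreover have "\<forall>i\<in>I. P i (?U i)"
      using U(1) U'(1) by simp
    ultimately show ?case by (intro exI[of _ ?U]) simp
  qed
  then obtain U where "\<forall>i\<in>I. P i (U i)" "list_all2 (interp f (\<lambda>p i x. Q p i (U i) x)) ws xs"
    using Sym.prems by fastforce
  then show ?case by (blast intro: interp.Sym)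
qed

text \<open>Registered so that inductive definitions may recurse through \<open>interp\<close>, as
  \<open>transl\<close> and \<open>joint\<close> do.\<close>

lemma interp_mono' [mono]:
  "(\<And>q i x. V q i x \<longrightarrow> V' q i x) \<Longrightarrow> interp f V w x \<longrightarrow> interp f V' w x"
  using interp_mono[of f V w x V'] by blast

text \<open>With \<open>id\<close> for \<open>c\<close> this types output trees, with
  \<open>Sym\<close> for \<open>c\<close> right-hand sides.\<close>

lemma interp_in_trees_over:
  assumes "w \<in> trees_over (embed_ranked \<Delta>) {Node (State q) [var i] | q i. C q i}"
    and "interp (\<lambda>a. Node (c a)) V w x"
    and "\<And>q i x. C q i \<Longrightarrow> V q i x \<Longrightarrow> x \<in> trees_over (\<lambda>k. c ` \<Delta> k) S"
  shows "x \<in> trees_over (\<lambda>k. c ` \<Delta> k) S"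
  using assms(1,2)
proof (induction arbitrary: x)
  case (base w)
  then show ?case using assms(3) by auto
next
  case (leaf a)
  then show ?case using trees_over.leaf[where \<Sigma> = "\<lambda>k. c ` \<Delta> k"] by auto
next
  case (node ws a)
  then obtain b xs where x: "a = Sym b" "x = Node (c b) xs" "list_all2 (interp (\<lambda>a. Node (c a)) V) ws xs"
    by auto
  have "t \<in> trees_over (\<lambda>k. c ` \<Delta> k) S" if "t \<in> set xs" for t
    using that x(3) node.IH by (metis in_set_conv_nth list_all2_conv_all_nth nth_mem)
  then show ?case
    using node.hyps x list_all2_lengthD[OF x(3)]
    by (auto intro!: trees_over.node)
qed

lemma Node_in_trees_iff: "Node a ts \<in> trees \<Sigma> \<longleftrightarrow> a \<in> \<Sigma> (length ts) \<and> set ts \<subseteq> trees \<Sigma>"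
proof
  assume "a \<in> \<Sigma> (length ts) \<and> set ts \<subseteq> trees \<Sigma>"
  then show "Node a ts \<in> trees \<Sigma>"
    by (cases "ts = []") (auto simp: Suc_le_eq intro: trees_over.leaf trees_over.node)
qed (auto elim: trees_over.cases)


section \<open>Big-step semantics\<close>

text \<open>The order of rewriting is abstracted away: each leaf of the applied right-hand side is
  translated on its own. The bound \<open>i < length ss\<close> guards the access
  \<open>ss ! i\<close>.\<close>

inductive transl :: "('a, 'q) rule set \<Rightarrow> 'q \<Rightarrow> 'a tree \<Rightarrow> 'a tree \<Rightarrow> bool" for R where
  "r \<in> R \<Longrightarrow> list_all2 (\<in>) ss (ranges r)
    \<Longrightarrow> interp Node (\<lambda>q i t. i < length ss \<and> transl R q (ss ! i) t) (rhs r) t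
    \<Longrightarrow> transl R (rule_state r) (Node (rule_sym r) ss) t"

lemma transl_Node_iff:
  "transl R q (Node a ss) t \<longleftrightarrow>
    (\<exists>r \<in> R. rule_state r = q \<and> rule_sym r = a \<and> list_all2 (\<in>) ss (ranges r) \<and>
      interp Node (\<lambda>q i t. i < length ss \<and> transl R q (ss ! i) t) (rhs r) t)"
  by (subst transl.simps) auto

text \<open>Reading a sentential form as an expression: a state denotes the relation it computes. States
  may be nested here, so that no invariant on sentential forms is needed.\<close>

inductive denotes :: "('a, 'q) rule set \<Rightarrow> ('a, 'q) sym tree \<Rightarrow> 'a tree \<Rightarrow> bool" for R where
  State: "denotes R x s \<Longrightarrow> transl R q s t \<Longrightarrow> denotes R (Node (State q) [x]) t"
| Sym: "list_all2 (denotes R) xs ts \<Longrightarrow> denotes R (Node (Sym a) xs) (Node a ts)"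
monos list.rel_mono

inductive_simps denotes_State_iff: "denotes R (Node (State q) xs) t"
inductive_simps denotes_Sym_iff: "denotes R (Node (Sym a) xs) t"
inductive_simps denotes_Var_iff: "denotes R (Node (Var i) xs) t"

lemmas denotes_simps [simp] = denotes_State_iff denotes_Sym_iff denotes_Var_iff

lemma denotes_embed [simp]: "denotes R (embed s) t \<longleftrightarrow> t = s"
proof (induction s arbitrary: t)
  case (Node a ss)
  have "list_all2 (denotes R) (map embed ss) ts \<longleftrightarrow> ts = map id ss" for ts
    unfolding list_all2_eq_map[symmetric] list_all2_map1
    by (rule list_all2_cong_left) (simp add: Node)
  then show ?case by auto
qed

lemma denotes_subst:
  assumes "w \<in> trees_over (embed_ranked \<Delta>) {Node (State q) [var i] | q i. C q i}"
    and "denotes R (subst (\<lambda>i. embed (\<phi> i)) w) t"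
  shows "interp Node (\<lambda>q i t. C q i \<and> transl R q (\<phi> i) t) w t"
  using assms
proof (induction arbitrary: t)
  case (base w)
  then show ?case by auto
next
  case (leaf a)
  then show ?case by auto
next
  case (node ws a)
  then obtain b ts where "a = Sym b" "t = Node b ts"
    "list_all2 (\<lambda>w. denotes R (subst (\<lambda>i. embed (\<phi> i)) w)) ws ts"
    by (auto simp: list_all2_map1)
  moreover from this(3) have "list_all2 (interp Node (\<lambda>q i t. C q i \<and> transl R q (\<phi> i) t)) ws ts"
    by (rule list.rel_mono_strong) (use node.IH in blast)
  ultimately show ?case by simp
qed

text \<open>Denotations are preserved when a step is read backwards. Induction from the end of a
  derivation thus reaches its first form, and derivation steps are never rearranged.\<close>

lemma denotes_step:
  assumes "step R x y" and "denotes R y t"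
    and "\<And>r. r \<in> R \<Longrightarrow> \<exists>\<Delta> Q. rhs r \<in> trees_over (embed_ranked \<Delta>)
      {Node (State q) [var i] | q i. q \<in> Q \<and> i < length (ranges r)}"
  shows "denotes R x t"
  using assms(1,2)
proof (induction arbitrary: t)
  case (apply_rule r \<phi>)
  let ?ss = "map \<phi> [0..<length (ranges r)]"
  obtain \<Delta> Q where rhs: "rhs r \<in> trees_over (embed_ranked \<Delta>)
      {Node (State q) [var i] | q i. q \<in> Q \<and> i < length (ranges r)}"
    using assms(3) apply_rule by blast
  have "interp Node (\<lambda>q i t. i < length ?ss \<and> transl R q (?ss ! i) t) (rhs r) t"
    using denotes_subst[OF rhs apply_rule.prems] by (rule interp_mono) auto
  then have "transl R (rule_state r) (Node (rule_sym r) ?ss) t"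
    using apply_rule.hyps by (intro transl.intros) (auto simp: list_all2_conv_all_nth)
  moreover have "subst (\<lambda>i. embed (\<phi> i)) (lhs r) =
      Node (State (rule_state r)) [embed (Node (rule_sym r) ?ss)]"
    by (simp add: lhs_def)
  ultimately show ?case
    by (simp only:) (auto intro: denotes.State simp del: tree.map)
next
  case (in_context x y z us vs)
  then show ?case
  proof (cases z)
    case (Sym a)
    then obtain ts\<^sub>1 t' ts\<^sub>2 where "t = Node a (ts\<^sub>1 @ t' # ts\<^sub>2)" "list_all2 (denotes R) us ts\<^sub>1"
      "denotes R y t'" "list_all2 (denotes R) vs ts\<^sub>2"
      using in_context.prems by (auto simp: list_all2_append1 list_all2_Cons1)
    then show ?thesis
      using Sym in_context.IH by (simp add: list_all2_appendI)
  qed (use in_context in \<open>auto simp: append_eq_Cons_conv\<close>)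
qed

section \<open>From big-step translations back to derivations\<close>

lemma steps_in_context:
  "(step R)\<^sup>*\<^sup>* t t' \<Longrightarrow> (step R)\<^sup>*\<^sup>* (Node x (us @ t # vs)) (Node x (us @ t' # vs))"
  by (induction rule: rtranclp_induct) (auto intro: rtranclp.rtrancl_into_rtrancl step.in_context)

lemma steps_in_contexts:
  assumes "list_all2 (step R)\<^sup>*\<^sup>* ts ts'"
  shows "(step R)\<^sup>*\<^sup>* (Node x (us @ ts)) (Node x (us @ ts'))"
  using assms
proof (induction arbitrary: us rule: list_all2_induct)
  case (Cons t ts t' ts')
  have "(step R)\<^sup>*\<^sup>* (Node x (us @ t # ts)) (Node x (us @ t' # ts))"
    using Cons.hyps by (intro steps_in_context)
  with Cons.IH[of "us @ [t']"] show ?case by simp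
qed simp

lemma steps_interp:
  assumes "interp Node (\<lambda>q i t. (step R)\<^sup>*\<^sup>* (Node (State q) [embed (\<phi> i)]) (embed t)) w t"
  shows "(step R)\<^sup>*\<^sup>* (subst (\<lambda>i. embed (\<phi> i)) w) (embed t)"
  using assms
proof (induction rule: interp.induct)
  case (Sym ws ts a)
  then have "list_all2 (step R)\<^sup>*\<^sup>* (map (subst (\<lambda>i. embed (\<phi> i))) ws) (map embed ts)"
    by (auto simp: list_all2_map1 list_all2_map2 intro: list_all2_mono)
  from steps_in_contexts[OF this, of "Sym a" "[]"] show ?case by simp
qed simp

lemma steps_transl:
  assumes "transl R q s t"
  shows "(step R)\<^sup>*\<^sup>* (Node (State q) [embed s]) (embed t)"
  using assms
proof (induction rule: transl.induct)
  case (1 r ss t)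
  have "step R (subst (\<lambda>i. embed (ss ! i)) (lhs r)) (subst (\<lambda>i. embed (ss ! i)) (rhs r))"
    using 1 by (intro step.apply_rule) (auto simp: list_all2_conv_all_nth)
  moreover have "subst (\<lambda>i. embed (ss ! i)) (lhs r) =
      Node (State (rule_state r)) [embed (Node (rule_sym r) ss)]"
    using 1 by (auto simp: lhs_def list_all2_conv_all_nth intro!: nth_equalityI)
  moreover have "(step R)\<^sup>*\<^sup>* (subst (\<lambda>i. embed (ss ! i)) (rhs r)) (embed t)"
    by (rule steps_interp, rule interp_mono[OF 1(3)]) auto
  ultimately show ?case by (metis converse_rtranclp_into_rtranclp)
qed

section \<open>Domain, range and functionality of translations\<close>

lemma rules_transducerD:
  assumes "transducer M" "r \<in> rules M"
  shows "rule_state r \<in> states M" "rule_sym r \<in> inputs M (length (ranges r))"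
    "L \<in> set (ranges r) \<Longrightarrow> recognizable (inputs M) L"
    "rhs r \<in> trees_over (embed_ranked (outputs M))
      {Node (State q) [var i] | q i. q \<in> states M \<and> i < length (ranges r)}"
  using assms by (auto simp: transducer_def rule_of_def Let_def)

lemma steps_iff_transl:
  assumes "transducer M"
  shows "(step (rules M))\<^sup>*\<^sup>* (Node (State q) [embed s]) (embed t) \<longleftrightarrow> transl (rules M) q s t"
proof
  have rhs: "\<exists>\<Delta> Q. rhs r \<in> trees_over (embed_ranked \<Delta>)
      {Node (State q) [var i] | q i. q \<in> Q \<and> i < length (ranges r)}" if "r \<in> rules M" for r
    using rules_transducerD(4)[OF assms that] by blast
  assume "(step (rules M))\<^sup>*\<^sup>* (Node (State q) [embed s]) (embed t)"
  then have "denotes (rules M) (Node (State q) [embed s]) t"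
    by (induction rule: converse_rtranclp_induct) (auto simp del: denotes_simps intro: denotes_step rhs)
  then show "transl (rules M) q s t" by simp
qed (rule steps_transl)

lemma transl_state:
  assumes "transducer M" "transl (rules M) q s t"
  shows "q \<in> states M"
  using assms(2) rules_transducerD(1)[OF assms(1)] by cases auto

text \<open>One inversion suffices: the ranges of the first rule are recognizable, hence contain
  only input trees, so the look-ahead certifies all immediate subtrees.\<close>

lemma transl_input:
  assumes "transducer M" "transl (rules M) q s t"
  shows "s \<in> trees (inputs M)"
  using assms(2)
proof cases
  case (1 r ss)
  have "ss ! i \<in> trees (inputs M)" if "i < length ss" for i
    using 1 that rules_transducerD(3)[OF assms(1), of r "ranges r ! i"]
    by (auto simp: list_all2_conv_all_nth recognizable_def)
  then show ?thesis
    using 1 rules_transducerD(2)[OF assms(1), of r]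
    by (auto simp: Node_in_trees_iff list_all2_lengthD in_set_conv_nth)
qed

lemma transl_output:
  assumes "transducer M" "transl (rules M) q s t"
  shows "t \<in> trees (outputs M)"
  using assms(2)
proof (induction rule: transl.induct)
  case (1 r ss t)
  from interp_in_trees_over[OF rules_transducerD(4)[OF assms(1) 1(1)], where c = id]
  show ?case using 1(3) by fastforce
qed

lemma realized_iff_transl:
  assumes "transducer M"
  shows "(s, t) \<in> realized M \<longleftrightarrow> (\<exists>q \<in> initial M. transl (rules M) q s t)"
  using transl_input[OF assms] transl_output[OF assms] steps_iff_transl[OF assms]
  by (fastforce simp: realized_def)

text \<open>Different rules with one left-hand side are separated at some position, so a common
  element at every position, possibly varying with the position, forces equality.\<close>

lemma deterministicD:
  assumes "deterministic M" "r \<in> rules M" "r' \<in> rules M"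
    and "rule_state r = rule_state r'" "rule_sym r = rule_sym r'"
    and "length (ranges r) = length (ranges r')"
    and "\<And>i. i < length (ranges r) \<Longrightarrow> \<exists>s. s \<in> ranges r ! i \<and> s \<in> ranges r' ! i"
  shows "r = r'"
proof (rule ccontr)
  assume "r \<noteq> r'"
  moreover have "lhs r = lhs r'" using assms by (simp add: lhs_def)
  ultimately show False using assms unfolding deterministic_def by (metis disjoint_iff)
qed

lemma transl_functional:
  assumes "deterministic M" "transl (rules M) q s t" "transl (rules M) q s t'"
  shows "t = t'"
  using assms(2,3)
proof (induction arbitrary: t' rule: transl.induct)
  case (1 r ss t)
  obtain r' where r': "r' \<in> rules M" "rule_state r' = rule_state r" "rule_sym r' = rule_sym r"
    "list_all2 (\<in>) ss (ranges r')"
    "interp Node (\<lambda>q i t. i < length ss \<and> transl (rules M) q (ss ! i) t) (rhs r') t'"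
    using 1(4) unfolding transl_Node_iff by blast
  have "\<exists>s. s \<in> ranges r ! i \<and> s \<in> ranges r' ! i" if "i < length (ranges r)" for i
    using 1(2) r'(4) that by (intro exI[of _ "ss ! i"]) (auto simp: list_all2_conv_all_nth)
  moreover have "length (ranges r) = length (ranges r')"
    using list_all2_lengthD[OF 1(2)] list_all2_lengthD[OF r'(4)] by simp
  ultimately have "r = r'"
    using 1(1) r'(1-3) by (intro deterministicD[OF assms(1)]) simp_all
  then show ?case
    using interp_functional[OF 1(3)] r'(5) by fastforce
qed

section \<open>Recognizability by finite congruences\<close>

text \<open>The kernel of \<open>h\<close> is a congruence of finite index on all trees of the type.
  Equality of the mapped lists includes equal lengths, so different ranks of one symbol stay
  apart.\<close>

definition finite_congruence :: "('a tree \<Rightarrow> 'b) \<Rightarrow> bool" where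
  "finite_congruence h \<longleftrightarrow> finite (range h) \<and>
    (\<forall>a ss ss'. map h ss = map h ss' \<longrightarrow> h (Node a ss) = h (Node a ss'))"

definition saturates :: "('a tree \<Rightarrow> 'b) \<Rightarrow> 'a tree set \<Rightarrow> bool" where
  "saturates h L \<longleftrightarrow> (\<forall>s s'. h s = h s' \<longrightarrow> s \<in> L \<longrightarrow> s' \<in> L)"

lemma finite_congruence_transition:
  assumes "finite_congruence h"
  obtains \<delta> where "\<And>a ss. h (Node a ss) = \<delta> a (map h ss)"
proof
  \<comment> \<open>The transition evaluates \<open>h\<close> on arbitrary representatives of the
    given classes; congruence makes the result independent of them.\<close>
  show "h (Node a ss) = (\<lambda>a vs. h (Node a (SOME ss. map h ss = vs))) a (map h ss)" for a ss
    using assms someI[of "\<lambda>ss'. map h ss' = map h ss" ss] unfolding finite_congruence_def by metis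
qed

lemma recognizable_if_saturates:
  fixes h :: "'a tree \<Rightarrow> 'b"
  assumes "finite_congruence h" "saturates h L" "L \<subseteq> trees \<Sigma>"
  shows "recognizable \<Sigma> L"
proof -
  obtain \<delta> where \<delta>: "\<And>a ss. h (Node a ss) = \<delta> a (map h ss)"
    using finite_congruence_transition[OF assms(1)] by blast
  \<comment> \<open>Automata have states in \<open>nat\<close>, so the finitely many classes are
    numbered.\<close>
  obtain e :: "'b \<Rightarrow> nat" where e: "inj_on e (range h)"
    using finite_imp_inj_to_nat_seg[of "range h"] assms(1) by (auto simp: finite_congruence_def)
  define H where "H = e \<circ> h"
  define d where "d = inv_into (range h) e"
  have d: "map d (map H ss) = map h ss" for ss
    using e by (simp add: H_def d_def)
  \<comment> \<open>Decoding by \<open>d\<close> is meaningful on \<open>range H\<close> only, which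
    is the state set; 0 is a default elsewhere.\<close>
  define \<delta>' where "\<delta>' = (\<lambda>(k :: nat) a vs. if set vs \<subseteq> range H then e (\<delta> a (map d vs)) else 0)"
  have H_Node: "H (Node a ss) = e (\<delta> a (map d (map H ss)))" for a ss
    unfolding d by (simp add: H_def \<delta>)
  have run: "run (\<lambda>a. H (Node a [])) \<delta>' t = H t" for t
  proof (induction t)
    case (Node a ts)
    then have eq: "map (run (\<lambda>a. H (Node a [])) \<delta>') ts = map H ts" by simp
    show ?case
    proof (cases "ts = []")
      case False
      with eq have "run (\<lambda>a. H (Node a [])) \<delta>' (Node a ts) = \<delta>' (length ts) a (map H ts)"
        by (simp only: run.simps if_False)
      then show ?thesis by (auto simp: \<delta>'_def H_Node[of a ts] simp del: map_map run.simps)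
    qed simp
  qed
  have "\<delta>' k a vs \<in> range H" if "set vs \<subseteq> range H" for k a vs
  proof -
    have "vs = map H (map (inv H) vs)"
      using that by (simp add: f_inv_into_f subset_iff map_idI)
    then obtain ss where "vs = map H ss" by blast
    then show ?thesis by (auto simp: \<delta>'_def H_Node[symmetric] simp del: map_map)
  qed
  moreover have "finite (range H)"
    using assms(1) by (simp only: H_def finite_congruence_def image_comp[symmetric] finite_imageI)
  ultimately have aut: "automaton \<Sigma> (range H) (H ` L) (\<lambda>a. H (Node a [])) \<delta>'"
    unfolding automaton_def by blast
  have "L = {t \<in> trees \<Sigma>. H t \<in> H ` L}"
  proof -
    have "t \<in> L" if "s \<in> L" "H t = H s" for s t
    proof -
      have "h s = h t" using that(2) e by (simp add: H_def inj_on_eq_iff)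
      with \<open>s \<in> L\<close> show ?thesis using assms(2) unfolding saturates_def by blast
    qed
    then show ?thesis using assms(3) by blast
  qed
  then have "L = {t \<in> trees \<Sigma>. run (\<lambda>a. H (Node a [])) \<delta>' t \<in> H ` L}"
    by (simp only: run)
  with aut show ?thesis
    unfolding recognizable_def by blast
qed

lemma recognizableE:
  assumes "recognizable \<Sigma> L"
  obtains h :: "'a tree \<Rightarrow> nat option" where "finite_congruence h" "saturates h L"
proof -
  obtain Q F s \<delta> where aut: "automaton \<Sigma> (Q :: nat set) F s \<delta>" and L: "L = {t \<in> trees \<Sigma>. run s \<delta> t \<in> F}"
    using assms unfolding recognizable_def by blast
  \<comment> \<open>The automaton is controlled on trees over \<Sigma> only. All other trees share
    the class \<open>None\<close>, which keeps the range finite and makes \<open>h\<close> a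
    congruence on the whole type.\<close>
  define h where "h = (\<lambda>t. if t \<in> trees \<Sigma> then Some (run s \<delta> t) else None)"
  have run: "t \<in> trees \<Sigma> \<Longrightarrow> run s \<delta> t \<in> Q" for t
  proof (induction t)
    case (Node a ts)
    then have "a \<in> \<Sigma> (length ts)" "set (map (run s \<delta>) ts) \<subseteq> Q"
      by (auto simp: Node_in_trees_iff)
    then show ?case
      using aut by (cases "ts = []") (simp_all add: automaton_def Suc_le_eq)
  qed
  have "range h \<subseteq> insert None (Some ` Q)"
    using run by (auto simp: h_def)
  moreover have "finite Q" using aut by (simp add: automaton_def)
  ultimately have "finite (range h)" by (metis finite_imageI finite_insert finite_subset)
  moreover have "h (Node a ss) = h (Node a ss')" if eq: "map h ss = map h ss'" for a ss ss'
  proof -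
    have len: "length ss = length ss'" using eq by (rule map_eq_imp_length_eq)
    have "set (map h ss) = set (map h ss')" using eq by simp
    then have in_trees: "set ss \<subseteq> trees \<Sigma> \<longleftrightarrow> set ss' \<subseteq> trees \<Sigma>"
      by (auto simp: h_def set_eq_iff image_iff split: if_splits)
    have "map (run s \<delta>) ss = map (run s \<delta>) ss'" if "set ss \<subseteq> trees \<Sigma>"
      using that eq in_trees len
      by (auto simp: h_def list_eq_iff_nth_eq subset_iff)
    then show ?thesis
      using in_trees len by (auto simp: h_def Node_in_trees_iff)
  qed
  ultimately have "finite_congruence h"
    unfolding finite_congruence_def by blast
  moreover have "saturates h L"
    by (auto simp: saturates_def h_def L split: if_splits)
  ultimately show ?thesis using that by blast
qed

lemma common_finite_congruence:
  assumes "finite LL" "\<And>L. L \<in> LL \<Longrightarrow> recognizable \<Sigma> L"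
  obtains h :: "'a tree \<Rightarrow> nat" where "finite_congruence h" "\<And>L. L \<in> LL \<Longrightarrow> saturates h L"
proof -
  have "\<exists>h :: 'a tree \<Rightarrow> nat. finite_congruence h \<and> (\<forall>L \<in> LL. saturates h L)"
    using assms
  proof (induction rule: finite_induct)
    case empty
    then show ?case by (intro exI[of _ "\<lambda>_. 0"]) (simp add: finite_congruence_def)
  next
    case (insert L LL)
    then obtain h :: "'a tree \<Rightarrow> nat" where h: "finite_congruence h" "\<forall>L \<in> LL. saturates h L"
      by auto
    obtain h' :: "'a tree \<Rightarrow> nat option" where h': "finite_congruence h'" "saturates h' L"
      using insert.prems recognizableE by blast
    \<comment> \<open>The product of the two congruences, coded in \<open>nat\<close> so that the
      type stays fixed along the induction.\<close>
    define k where "k = (\<lambda>t. to_nat (h t, h' t))"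
    have k: "k s = k s' \<longleftrightarrow> h s = h s' \<and> h' s = h' s'" for s s'
      by (simp add: k_def)
    have "range k \<subseteq> to_nat ` (range h \<times> range h')"
      by (auto simp: k_def)
    then have "finite (range k)"
      by (rule finite_subset) (use h(1) h'(1) in \<open>simp add: finite_congruence_def\<close>)
    moreover have "k (Node a ss) = k (Node a ss')" if eq: "map k ss = map k ss'" for a ss ss'
    proof -
      have "map h ts = map (\<lambda>n. fst (from_nat n :: nat \<times> nat option)) (map k ts)"
        "map h' ts = map (\<lambda>n. snd (from_nat n :: nat \<times> nat option)) (map k ts)" for ts
        by (simp_all add: k_def)
      from this[of ss] this[of ss'] have "map h ss = map h ss'" "map h' ss = map h' ss'"
        unfolding eq by simp_all
      then show ?thesis
        using h(1) h'(1) unfolding k finite_congruence_def by blast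
    qed
    ultimately have "finite_congruence k"
      unfolding finite_congruence_def by blast
    moreover have "\<forall>L \<in> insert L LL. saturates k L"
      using h(2) h'(2) by (auto simp: saturates_def k)
    ultimately show ?case by blast
  qed
  then show ?thesis using that by blast
qed

lemma transducer_congruence:
  assumes "transducer M"
  obtains h :: "'a tree \<Rightarrow> nat" where "finite_congruence h"
    "\<And>r L. r \<in> rules M \<Longrightarrow> L \<in> set (ranges r) \<Longrightarrow> saturates h L"
proof -
  have "finite (\<Union>r \<in> rules M. set (ranges r))"
    using assms by (auto simp: transducer_def)
  moreover have "recognizable (inputs M) L" if "L \<in> (\<Union>r \<in> rules M. set (ranges r))" for L
    using that rules_transducerD(3)[OF assms] by blast
  ultimately obtain h :: "'a tree \<Rightarrow> nat" where "finite_congruence h"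
    "\<And>L. L \<in> (\<Union>r \<in> rules M. set (ranges r)) \<Longrightarrow> saturates h L"
    using common_finite_congruence by blast
  then show ?thesis by (intro that) auto
qed

section \<open>The composite transducer\<close>

text \<open>A state \<open>pair q p c\<close> translates \<open>s\<close> to every \<open>t\<close> such that, for some \<open>u\<close>, \<open>M\<^sub>1\<close> translates
  \<open>s\<close> to \<open>u\<close> from \<open>q\<close> and \<open>M\<^sub>2\<close> translates \<open>u\<close> to \<open>t\<close> from \<open>p\<close>; if \<open>c = Some v\<close>, then \<open>u\<close> must also
  have the look-ahead value \<open>h\<^sub>2 u = v\<close>. This constraint is needed when \<open>M\<^sub>1\<close> is nondeterministic:
  the look-ahead value of \<open>u\<close> is guessed before \<open>u\<close> is produced. When \<open>M\<^sub>1\<close> is deterministic, the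
  value is determined by the input, and not recording it keeps the composite deterministic.\<close>

abbreviation pair :: "nat \<Rightarrow> nat \<Rightarrow> nat option \<Rightarrow> nat" where
  "pair q p c \<equiv> to_nat (q, p, c)"

text \<open>One construction serves both cases: \<open>guessing\<close> decides whether look-ahead
  values are recorded in states, and which of linearity and determinism may be used in
  return.\<close>

locale composition =
  fixes M\<^sub>1 M\<^sub>2 :: "('a, nat) transducer" and h\<^sub>1 h\<^sub>2 :: "'a tree \<Rightarrow> nat"
    and \<delta> :: "'a \<Rightarrow> nat list \<Rightarrow> nat" and guessing :: bool
  assumes M\<^sub>1: "transducer M\<^sub>1" and M\<^sub>2: "transducer M\<^sub>2"
    and h\<^sub>1: "finite_congruence h\<^sub>1" and h\<^sub>2: "finite_congruence h\<^sub>2"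
    and saturates\<^sub>1: "\<And>r L. r \<in> rules M\<^sub>1 \<Longrightarrow> L \<in> set (ranges r) \<Longrightarrow> saturates h\<^sub>1 L"
    and saturates\<^sub>2: "\<And>r L. r \<in> rules M\<^sub>2 \<Longrightarrow> L \<in> set (ranges r) \<Longrightarrow> saturates h\<^sub>2 L"
    and h\<^sub>2_Node: "\<And>a us. h\<^sub>2 (Node a us) = \<delta> a (map h\<^sub>2 us)"
    and guessing: "guessing \<Longrightarrow> linear M\<^sub>2" "\<not> guessing \<Longrightarrow> deterministic M\<^sub>1"
begin

abbreviation transl\<^sub>1 where "transl\<^sub>1 \<equiv> transl (rules M\<^sub>1)"
abbreviation transl\<^sub>2 where "transl\<^sub>2 \<equiv> transl (rules M\<^sub>2)"

definition guess :: "nat \<Rightarrow> nat option" where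
  "guess v = (if guessing then Some v else None)"

text \<open>\<open>joint A p w v t\<close>: \<open>M\<^sub>2\<close>, started in state \<open>p\<close> on the right-hand side \<open>w\<close> of a rule of \<open>M\<^sub>1\<close>,
  produces \<open>t\<close>, where \<open>v\<close> is the look-ahead value of the tree that \<open>w\<close> stands for, and
  \<open>A q j v\<close> says that \<open>v\<close> is a possible look-ahead value at a leaf \<open>q[x\<^sub>j]\<close>.\<close>

inductive joint ::
    "(nat \<Rightarrow> nat \<Rightarrow> nat \<Rightarrow> bool) \<Rightarrow> nat \<Rightarrow> ('a, nat) sym tree \<Rightarrow> nat \<Rightarrow> ('a, nat) sym tree \<Rightarrow> bool"
  for A where
  State: "A q j v \<Longrightarrow> joint A p (Node (State q) [var j]) v (Node (State (pair q p (guess v))) [var j])"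
| Sym: "r \<in> rules M\<^sub>2 \<Longrightarrow> list_all2 (interp \<delta> A) ws vs \<Longrightarrow>
    list_all2 (\<lambda>v L. v \<in> h\<^sub>2 ` L) vs (ranges r) \<Longrightarrow>
    interp (\<lambda>a. Node (Sym a)) (\<lambda>p i t. i < length ws \<and> joint A p (ws ! i) (vs ! i) t) (rhs r) t \<Longrightarrow>
    joint A (rule_state r) (Node (Sym (rule_sym r)) ws) (\<delta> (rule_sym r) vs) t"

lemma joint_State_iff: "joint A p (Node (State q) ws) v t \<longleftrightarrow>
    (\<exists>j. ws = [var j] \<and> A q j v \<and> t = Node (State (pair q p (guess v))) [var j])"
  by (subst joint.simps) auto

lemma joint_Sym_iff: "joint A p (Node (Sym a) ws) v t \<longleftrightarrow>
    (\<exists>r \<in> rules M\<^sub>2. \<exists>vs. rule_state r = p \<and> rule_sym r = a \<and> v = \<delta> a vs \<and>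
      list_all2 (interp \<delta> A) ws vs \<and> list_all2 (\<lambda>v L. v \<in> h\<^sub>2 ` L) vs (ranges r) \<and>
      interp (\<lambda>a. Node (Sym a)) (\<lambda>p i t. i < length ws \<and> joint A p (ws ! i) (vs ! i) t) (rhs r) t)"
  by (subst joint.simps) auto

lemma joint_Var_iff: "\<not> joint A p (Node (Var i) ws) v t"
  by (subst joint.simps) auto

text \<open>Saturation lets the value alone decide membership in a range, so \<open>joint\<close>
  can test the look-ahead without knowing the tree.\<close>

lemma range_iff:
  assumes "r \<in> rules M\<^sub>2" "L \<in> set (ranges r)"
  shows "h\<^sub>2 u \<in> h\<^sub>2 ` L \<longleftrightarrow> u \<in> L"
  using saturates\<^sub>2[OF assms] unfolding saturates_def by (metis image_iff)

lemma list_range_iff: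
  assumes "r \<in> rules M\<^sub>2"
  shows "list_all2 (\<lambda>v L. v \<in> h\<^sub>2 ` L) (map h\<^sub>2 us) (ranges r) \<longleftrightarrow> list_all2 (\<in>) us (ranges r)"
  using range_iff[OF assms] by (auto simp: list_all2_conv_all_nth simp del: image_iff)

text \<open>\<open>K\<close> stands for the first transducer on the subtrees, \<open>G\<close> for
  the composite. The composite chooses an intermediate tree separately at each leaf, whereas a run
  of \<open>M\<^sub>2\<close> needs one tree per child. These choices are reconciled by linearity,
  when each child is used at most once, or by uniqueness of the intermediate trees.\<close>

lemma joint_correct:
  fixes K G :: "nat \<Rightarrow> nat \<Rightarrow> 'a tree \<Rightarrow> bool"
  assumes G: "\<And>q p c j t. G (pair q p c) j t \<longleftrightarrow>
      (\<exists>u. K q j u \<and> transl\<^sub>2 p u t \<and> (c = None \<or> c = Some (h\<^sub>2 u)))"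
    and K: "\<And>q j u u'. \<not> guessing \<Longrightarrow> K q j u \<Longrightarrow> K q j u' \<Longrightarrow> u = u'"
  shows "(\<exists>t'. joint (\<lambda>q j v. \<exists>u. K q j u \<and> v = h\<^sub>2 u) p w v t' \<and> interp Node G t' t) \<longleftrightarrow>
    (\<exists>u. interp Node K w u \<and> transl\<^sub>2 p u t \<and> v = h\<^sub>2 u)"
    (is "(\<exists>t'. joint ?A p w v t' \<and> _) \<longleftrightarrow> _")
proof (induction w arbitrary: p v t)
  case (Node s ws)
  show ?case
  proof (cases s)
    case (Sym b)
    let ?n = "length ws"
    let ?P = "\<lambda>vs i u. i < ?n \<and> interp Node K (ws ! i) u \<and> vs ! i = h\<^sub>2 u"
    have IH: "(\<exists>t'. (i < ?n \<and> joint ?A p (ws ! i) (vs ! i) t') \<and> interp Node G t' t) \<longleftrightarrow>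
        (\<exists>u. ?P vs i u \<and> transl\<^sub>2 p u t)" for p i vs t
      using Node[of "ws ! i" p "vs ! i" t] by (cases "i < ?n") auto
    have fusion: "interp \<delta> ?A w v \<longleftrightarrow> (\<exists>u. interp Node K w u \<and> v = h\<^sub>2 u)" for w v
      using interp_fusion[of h\<^sub>2 \<delta> K] h\<^sub>2_Node by blast
    have assoc: "(\<exists>t'. interp (\<lambda>a. Node (Sym a)) (\<lambda>p i t. i < ?n \<and> joint ?A p (ws ! i) (vs ! i) t) z t'
          \<and> interp Node G t' t) \<longleftrightarrow>
        interp Node (\<lambda>p i t. \<exists>u. ?P vs i u \<and> transl\<^sub>2 p u t) z t" for vs z t
      unfolding interp_assoc[symmetric] IH ..
    \<comment> \<open>Only here do the two cases differ. Children that the rule does not visit still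
      need a tree with the assumed value, which \<open>vs\<close> provides.\<close>
    have choice: "\<exists>U. (\<forall>i<?n. ?P vs i (U i)) \<and> interp Node (\<lambda>p i t. i < ?n \<and> transl\<^sub>2 p (U i) t) (rhs r) t"
      if r: "r \<in> rules M\<^sub>2" and vs: "list_all2 (interp \<delta> ?A) ws vs"
        and int: "interp Node (\<lambda>p i t. \<exists>u. ?P vs i u \<and> transl\<^sub>2 p u t) (rhs r) t" for r vs t
    proof -
      have ex: "\<exists>u. ?P vs i u" if "i < ?n" for i
        using vs that by (auto simp: list_all2_conv_all_nth fusion)
      show ?thesis
      proof (cases guessing)
        case True
        have "count_list (symbols (rhs r)) (Var i) \<le> 1" for i
          using guessing(1)[OF True] r by (simp add: linear_def)
        moreover have "interp Node (\<lambda>p i t. \<exists>u. ?P vs i u \<and> (i < ?n \<and> transl\<^sub>2 p u t)) (rhs r) t"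
          using int by (rule interp_mono) blast
        ultimately show ?thesis
          using interp_linear_choice[of Node "?P vs" "\<lambda>p i u t. i < ?n \<and> transl\<^sub>2 p u t" "rhs r" t "{..<?n}"] ex
          by blast
      next
        case False
        have unique: "u = u'" if "?P vs i u" "?P vs i u'" for i u u'
          using that interp_functional[where V = K and V' = K] K[OF False] by blast
        obtain U where U: "\<forall>i<?n. ?P vs i (U i)" using ex by metis
        have "interp Node (\<lambda>p i t. i < ?n \<and> transl\<^sub>2 p (U i) t) (rhs r) t"
          using int by (rule interp_mono) (use U unique in blast)
        with U show ?thesis by blast
      qed
    qed
    show ?thesis
    proof
      assume "\<exists>t'. joint ?A p (Node s ws) v t' \<and> interp Node G t' t"
      then obtain r vs where r: "r \<in> rules M\<^sub>2" "rule_state r = p" "rule_sym r = b" "v = \<delta> b vs"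
        and vs: "list_all2 (interp \<delta> ?A) ws vs" "list_all2 (\<lambda>v L. v \<in> h\<^sub>2 ` L) vs (ranges r)"
        and int: "interp Node (\<lambda>p i t. \<exists>u. ?P vs i u \<and> transl\<^sub>2 p u t) (rhs r) t"
        unfolding Sym joint_Sym_iff assoc[symmetric] by blast
      obtain U where U: "\<forall>i<?n. ?P vs i (U i)"
        "interp Node (\<lambda>p i t. i < ?n \<and> transl\<^sub>2 p (U i) t) (rhs r) t"
        using choice[OF r(1) vs(1) int] by blast
      define us where "us = map U [0..<?n]"
      have vs_eq: "vs = map h\<^sub>2 us"
        using U(1) vs(1) by (auto simp: us_def list_all2_lengthD intro!: nth_equalityI)
      have "interp Node (\<lambda>p i t. i < length us \<and> transl\<^sub>2 p (us ! i) t) (rhs r) t"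
        using U(2) by (rule interp_mono) (auto simp: us_def)
      moreover have "list_all2 (\<in>) us (ranges r)"
        using vs(2) list_range_iff[OF r(1)] unfolding vs_eq by simp
      ultimately have "transl\<^sub>2 p (Node b us) t"
        using r by (auto intro!: transl.intros)
      moreover have "list_all2 (interp Node K) ws us"
        using U(1) by (auto simp: us_def list_all2_conv_all_nth)
      ultimately show "\<exists>u. interp Node K (Node s ws) u \<and> transl\<^sub>2 p u t \<and> v = h\<^sub>2 u"
        unfolding Sym r(4) vs_eq by (intro exI[of _ "Node b us"]) (auto simp: h\<^sub>2_Node)
    next
      assume "\<exists>u. interp Node K (Node s ws) u \<and> transl\<^sub>2 p u t \<and> v = h\<^sub>2 u"
      then obtain us where us: "list_all2 (interp Node K) ws us" "transl\<^sub>2 p (Node b us) t"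
        and v: "v = \<delta> b (map h\<^sub>2 us)"
        using Sym by (auto simp: h\<^sub>2_Node)
      obtain r where r: "r \<in> rules M\<^sub>2" "rule_state r = p" "rule_sym r = b" "list_all2 (\<in>) us (ranges r)"
        and int: "interp Node (\<lambda>p i t. i < length us \<and> transl\<^sub>2 p (us ! i) t) (rhs r) t"
        using us(2) unfolding transl_Node_iff by blast
      let ?vs = "map h\<^sub>2 us"
      have "interp Node (\<lambda>p i t. \<exists>u. ?P ?vs i u \<and> transl\<^sub>2 p u t) (rhs r) t"
        using int by (rule interp_mono) (use us(1) in \<open>auto simp: list_all2_conv_all_nth\<close>)
      moreover have "list_all2 (interp \<delta> ?A) ws ?vs"
        using us(1) by (auto simp: list_all2_conv_all_nth fusion)
      moreover have "list_all2 (\<lambda>v L. v \<in> h\<^sub>2 ` L) ?vs (ranges r)"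
        using r list_range_iff by blast
      ultimately show "\<exists>t'. joint ?A p (Node s ws) v t' \<and> interp Node G t' t"
        unfolding Sym joint_Sym_iff v assoc[symmetric] using r(1-3) by blast
    qed
  next
    case (State q)
    show ?thesis
    proof (cases "\<exists>j. ws = [var j]")
      case True
      then obtain j where "ws = [var j]" by blast
      \<comment> \<open>A guessed value is enforced by the constraint in the leaf state; without
        guessing, \<open>K\<close> makes the tree and hence its value unique.\<close>
      then show ?thesis
        using State G by (auto simp: joint_State_iff guess_def dest: K)
    qed (use State in \<open>auto simp: joint_State_iff\<close>)
  qed (simp add: joint_Var_iff)
qed

lemma joint_mono:
  assumes "joint A p w v t" and "\<And>q j v. A q j v \<Longrightarrow> B q j v"
  shows "joint B p w v t"
  using assms(1)
proof (induction rule: joint.induct)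
  case (State q j v p)
  then show ?case by (auto intro!: joint.State assms(2))
next
  case (Sym r ws vs t)
  show ?case
  proof (rule joint.Sym[OF Sym(1) _ Sym(3)])
    show "list_all2 (interp \<delta> B) ws vs"
      using Sym(2) by (rule list_all2_mono) (erule interp_mono, rule assms(2))
    show "interp (\<lambda>a. Node (Sym a)) (\<lambda>p i t. i < length ws \<and> joint B p (ws ! i) (vs ! i) t) (rhs r) t"
      using Sym(4) by (rule interp_mono) blast
  qed
qed

text \<open>Unique leaf values give unique values of the children. Two applicable rules then have,
  at each position, ranges meeting the same class; by saturation they share a tree, and determinism
  identifies the rules.\<close>

lemma joint_functional:
  assumes "deterministic M\<^sub>2" and A: "\<And>q j v v'. A q j v \<Longrightarrow> A q j v' \<Longrightarrow> v = v'"
    and "joint A p w v t" "joint A p w v' t'"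
  shows "v = v' \<and> t = t'"
  using assms(3,4)
proof (induction arbitrary: v' t' rule: joint.induct)
  case (State q j v p)
  then have "v = v'" "t' = Node (State (pair q p (guess v'))) [var j]"
    by (auto simp: joint_State_iff dest: A)
  then show ?case by simp
next
  case (Sym r ws vs t)
  from Sym.prems obtain r' vs' where r': "r' \<in> rules M\<^sub>2" "rule_state r' = rule_state r"
    "rule_sym r' = rule_sym r" "v' = \<delta> (rule_sym r) vs'"
    and vs': "list_all2 (interp \<delta> A) ws vs'" "list_all2 (\<lambda>v L. v \<in> h\<^sub>2 ` L) vs' (ranges r')"
    and int: "interp (\<lambda>a. Node (Sym a)) (\<lambda>p i t. i < length ws \<and> joint A p (ws ! i) (vs' ! i) t) (rhs r') t'"
    unfolding joint_Sym_iff by blast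
  have vs: "vs = vs'"
  proof (rule nth_equalityI)
    fix i assume "i < length vs"
    then have "interp \<delta> A (ws ! i) (vs ! i)" "interp \<delta> A (ws ! i) (vs' ! i)"
      using Sym.hyps(2) vs'(1) by (simp_all add: list_all2_conv_all_nth)
    then show "vs ! i = vs' ! i" by (rule interp_functional) (rule A)
  next
    show "length vs = length vs'"
      using list_all2_lengthD[OF Sym.hyps(2)] list_all2_lengthD[OF vs'(1)] by simp
  qed
  have len: "length (ranges r) = length (ranges r')"
    using list_all2_lengthD[OF Sym.hyps(3)] list_all2_lengthD[OF vs'(2)] vs by simp
  have "\<exists>s. s \<in> ranges r ! i \<and> s \<in> ranges r' ! i" if i: "i < length (ranges r)" for i
  proof -
    have "vs ! i \<in> h\<^sub>2 ` (ranges r ! i)" "vs ! i \<in> h\<^sub>2 ` (ranges r' ! i)"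
      using Sym.hyps(3) vs'(2) i len vs by (auto simp: list_all2_conv_all_nth simp del: image_iff)
    then obtain s where "s \<in> ranges r ! i" "h\<^sub>2 s \<in> h\<^sub>2 ` (ranges r' ! i)" by (metis imageE)
    then show ?thesis using range_iff[OF r'(1), of "ranges r' ! i" s] i len by auto
  qed
  then have "r = r'"
    using Sym.hyps(1) r' len by (intro deterministicD[OF assms(1)]) simp_all
  have "t = t'"
    using Sym(4) int unfolding vs \<open>r = r'\<close> by (rule interp_functional) (use Sym.IH in blast)
  then show ?case using vs r'(4) by simp
qed

lemma finite_joint:
  assumes A: "\<And>q j. finite {v. A q j v}"
  shows "finite {(v, t). joint A p w v t}"
proof (induction w arbitrary: p)
  case (Node s ws)
  show ?case
  proof (cases s)
    case (Sym a)
    let ?V = "{vs. list_all2 (interp \<delta> A) ws vs}"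
    let ?T = "\<lambda>r vs. {t. interp (\<lambda>a. Node (Sym a)) (\<lambda>p i t. i < length ws \<and> joint A p (ws ! i) (vs ! i) t) (rhs r) t}"
    have "finite ?V"
      by (intro finite_list_all2 finite_interp A)
    moreover have "finite (?T r vs)" for r vs
    proof (rule finite_interp)
      fix p i
      show "finite {t. i < length ws \<and> joint A p (ws ! i) (vs ! i) t}"
      proof (cases "i < length ws")
        case True
        have "{t. joint A p (ws ! i) (vs ! i) t} \<subseteq> snd ` {(v, t). joint A p (ws ! i) v t}"
          by force
        with True Node[of "ws ! i" p] show ?thesis by (auto intro: finite_subset)
      qed simp
    qed
    moreover have "finite (rules M\<^sub>2)"
      using M\<^sub>2 by (simp add: transducer_def)
    ultimately have "finite (\<Union>r \<in> rules M\<^sub>2. \<Union>vs \<in> ?V. {\<delta> a vs} \<times> ?T r vs)"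
      by blast
    moreover have "{(v, t). joint A p (Node s ws) v t} \<subseteq> (\<Union>r \<in> rules M\<^sub>2. \<Union>vs \<in> ?V. {\<delta> a vs} \<times> ?T r vs)"
      by (auto simp: Sym joint_Sym_iff)
    ultimately show ?thesis by (rule finite_subset[rotated])
  next
    case (State q)
    \<comment> \<open>The \<open>case\<close> expression reads the variable index off
      \<open>ws\<close>; if \<open>ws\<close> has another shape, the left-hand set is empty.\<close>
    have "{(v, t). joint A p (Node s ws) v t} \<subseteq>
        (\<lambda>v. (v, Node (State (pair q p (guess v))) ws)) ` {v. A q (case ws of [Node (Var j) _] \<Rightarrow> j) v}"
      by (auto simp: State joint_State_iff)
    then show ?thesis by (rule finite_subset) (intro finite_imageI A)
  qed (simp add: joint_Var_iff)
qed

definition constraints :: "nat option set" where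
  "constraints = insert None (Some ` range h\<^sub>2)"

lemma finite_constraints: "finite constraints"
  using h\<^sub>2 by (simp add: constraints_def finite_congruence_def)

definition composite_states :: "nat set" where
  "composite_states = to_nat ` (states M\<^sub>1 \<times> states M\<^sub>2 \<times> constraints)"

lemma joint_rhs:
  assumes "joint A p w v t" "p \<in> states M\<^sub>2"
    and "\<And>q j v. A q j v \<Longrightarrow> q \<in> states M\<^sub>1 \<and> j < k \<and> v \<in> range h\<^sub>2"
  shows "t \<in> trees_over (embed_ranked (outputs M\<^sub>2))
    {Node (State q) [var i] | q i. q \<in> composite_states \<and> i < k}"
  using assms(1,2)
proof (induction rule: joint.induct)
  case (State q j v p)
  then show ?case
    using assms(3)[OF State(1)]
    by (auto simp: composite_states_def guess_def constraints_def intro!: trees_over.base)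
next
  case (Sym r ws vs t)
  show ?case
    by (rule interp_in_trees_over[OF rules_transducerD(4)[OF M\<^sub>2 Sym(1)] Sym(4)]) (use Sym.IH in blast)
qed

section \<open>Profiles of input trees as look-ahead of the composite\<close>

definition leaf_values :: "'a tree list \<Rightarrow> nat \<Rightarrow> nat \<Rightarrow> nat \<Rightarrow> bool" where
  "leaf_values ss q j v \<longleftrightarrow> (\<exists>u. (j < length ss \<and> transl\<^sub>1 q (ss ! j) u) \<and> v = h\<^sub>2 u)"

text \<open>The first component decides which ranges of \<open>M\<^sub>1\<close> contain the tree,
  the second predicts the look-ahead values of its translations.\<close>

definition profile :: "'a tree \<Rightarrow> nat \<times> (nat \<times> nat) set" where
  "profile s = (h\<^sub>1 s, {(q, v). \<exists>u. transl\<^sub>1 q s u \<and> v = h\<^sub>2 u})"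

lemma leaf_values_cong:
  assumes "map profile ss = map profile ss'"
  shows "leaf_values ss = leaf_values ss'"
proof -
  have len: "length ss = length ss'" using assms by (rule map_eq_imp_length_eq)
  have "(\<exists>u. transl\<^sub>1 q (ss ! j) u \<and> v = h\<^sub>2 u) \<longleftrightarrow> (\<exists>u. transl\<^sub>1 q (ss' ! j) u \<and> v = h\<^sub>2 u)"
    if "j < length ss" for q j v
  proof -
    have "profile (ss ! j) = profile (ss' ! j)"
      using assms that len by (metis nth_map)
    then show ?thesis by (simp add: profile_def set_eq_iff)
  qed
  then show ?thesis unfolding leaf_values_def fun_eq_iff len by blast
qed

lemma ranges_cong:
  assumes "r \<in> rules M\<^sub>1" "map profile ss = map profile ss'"
  shows "list_all2 (\<in>) ss (ranges r) \<Longrightarrow> list_all2 (\<in>) ss' (ranges r)"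
proof -
  assume ss: "list_all2 (\<in>) ss (ranges r)"
  have len: "length ss = length ss'" using assms(2) by (rule map_eq_imp_length_eq)
  show ?thesis
    unfolding list_all2_conv_all_nth
  proof (intro conjI allI impI)
    fix i assume i: "i < length ss'"
    have "profile (ss ! i) = profile (ss' ! i)"
      using assms(2) i len by (metis nth_map)
    then have "h\<^sub>1 (ss ! i) = h\<^sub>1 (ss' ! i)" by (simp add: profile_def)
    moreover have "ss ! i \<in> ranges r ! i" "ranges r ! i \<in> set (ranges r)"
      using ss i len by (auto simp: list_all2_conv_all_nth)
    ultimately show "ss' ! i \<in> ranges r ! i"
      using saturates\<^sub>1[OF assms(1)] unfolding saturates_def by blast
  qed (use ss len in \<open>simp add: list_all2_lengthD\<close>)
qed

text \<open>The children enter the right-hand side only through range membership and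
  \<open>leaf_values\<close>, both determined by their profiles. This makes \<open>profile\<close> a
  congruence.\<close>

lemma leaf_values_Node:
  "(\<exists>u. transl\<^sub>1 q (Node a ss) u \<and> v = h\<^sub>2 u) \<longleftrightarrow>
    (\<exists>r \<in> rules M\<^sub>1. rule_state r = q \<and> rule_sym r = a \<and> list_all2 (\<in>) ss (ranges r) \<and>
      interp \<delta> (leaf_values ss) (rhs r) v)"
proof -
  have "interp \<delta> (leaf_values ss) w v \<longleftrightarrow>
      (\<exists>u. interp Node (\<lambda>q i t. i < length ss \<and> transl\<^sub>1 q (ss ! i) t) w u \<and> v = h\<^sub>2 u)" for w
    unfolding leaf_values_def[abs_def] by (rule interp_fusion) (rule h\<^sub>2_Node)
  then show ?thesis unfolding transl_Node_iff by blast
qed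

lemma finite_congruence_profile: "finite_congruence profile"
  unfolding finite_congruence_def
proof (intro conjI allI impI)
  have "range profile \<subseteq> range h\<^sub>1 \<times> Pow (states M\<^sub>1 \<times> range h\<^sub>2)"
    using transl_state[OF M\<^sub>1] by (auto simp: profile_def)
  moreover have "finite (range h\<^sub>1 \<times> Pow (states M\<^sub>1 \<times> range h\<^sub>2))"
    using h\<^sub>1 h\<^sub>2 M\<^sub>1 by (simp add: finite_congruence_def transducer_def)
  ultimately show "finite (range profile)" by (rule finite_subset)
next
  fix a ss ss' assume eq: "map profile ss = map profile ss'"
  have "map fst (map profile ss) = map fst (map profile ss')" using eq by simp
  then have "map h\<^sub>1 ss = map h\<^sub>1 ss'" by (simp add: profile_def comp_def)
  then have "h\<^sub>1 (Node a ss) = h\<^sub>1 (Node a ss')"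
    using h\<^sub>1 unfolding finite_congruence_def by blast
  moreover have "list_all2 (\<in>) ss (ranges r) \<longleftrightarrow> list_all2 (\<in>) ss' (ranges r)" if "r \<in> rules M\<^sub>1" for r
    using ranges_cong[OF that eq] ranges_cong[OF that eq[symmetric]] by blast
  ultimately show "profile (Node a ss) = profile (Node a ss')"
    unfolding profile_def leaf_values_Node leaf_values_cong[OF eq] by auto
qed

section \<open>Construction and correctness of the composite\<close>

definition profile_class :: "'a tree \<Rightarrow> 'a tree set" where
  "profile_class s = {s'. profile s' = profile s}"

lemma map_profile_class_iff:
  "list_all2 (\<in>) ss' (map profile_class ss) \<longleftrightarrow> map profile ss' = map profile ss"
  by (auto simp: list_all2_conv_all_nth profile_class_def list_eq_iff_nth_eq)

text \<open>The trees \<open>ss\<close> only represent a tuple of profiles, on which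
  \<open>leaf_values ss\<close> depends. Using whole profile classes as ranges makes any two ranges
  equal or disjoint, which later yields determinism.\<close>

definition composite :: "('a, nat) transducer" where
  "composite = \<lparr>states = composite_states, inputs = inputs M\<^sub>1, outputs = outputs M\<^sub>2,
     rules = {Rule (pair (rule_state r) p c) (rule_sym r) (map profile_class ss) t | r p c ss t.
       r \<in> rules M\<^sub>1 \<and> p \<in> states M\<^sub>2 \<and> c \<in> constraints \<and> list_all2 (\<in>) ss (ranges r) \<and>
       (\<exists>v. joint (leaf_values ss) p (rhs r) v t \<and> (c = None \<or> c = Some v))},
     initial = {pair q p None | q p. q \<in> initial M\<^sub>1 \<and> p \<in> initial M\<^sub>2}\<rparr>"

lemma composite_ruleE:
  assumes "R \<in> rules composite"
  obtains r p c ss t v where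
    "R = Rule (pair (rule_state r) p c) (rule_sym r) (map profile_class ss) t"
    "r \<in> rules M\<^sub>1" "p \<in> states M\<^sub>2" "c \<in> constraints" "list_all2 (\<in>) ss (ranges r)"
    "joint (leaf_values ss) p (rhs r) v t" "c = None \<or> c = Some v"
proof -
  from assms have "\<exists>r p c ss t. R = Rule (pair (rule_state r) p c) (rule_sym r) (map profile_class ss) t \<and>
      r \<in> rules M\<^sub>1 \<and> p \<in> states M\<^sub>2 \<and> c \<in> constraints \<and> list_all2 (\<in>) ss (ranges r) \<and>
      (\<exists>v. joint (leaf_values ss) p (rhs r) v t \<and> (c = None \<or> c = Some v))"
    by (simp add: composite_def)
  then show ?thesis using that by blast
qed

lemma transl_composite:
  "transl (rules composite) (pair q p c) s t \<longleftrightarrow>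
    (\<exists>u. transl\<^sub>1 q s u \<and> transl\<^sub>2 p u t \<and> (c = None \<or> c = Some (h\<^sub>2 u)))"
proof (induction s arbitrary: q p c t)
  case (Node a ss)
  let ?K = "\<lambda>q j u. j < length ss \<and> transl\<^sub>1 q (ss ! j) u"
  let ?G = "\<lambda>q j t. j < length ss \<and> transl (rules composite) q (ss ! j) t"
  have correct: "(\<exists>t'. joint (leaf_values ss) p w v t' \<and> interp Node ?G t' t) \<longleftrightarrow>
      (\<exists>u. interp Node ?K w u \<and> transl\<^sub>2 p u t \<and> v = h\<^sub>2 u)" for p w v t
    unfolding leaf_values_def[abs_def]
  proof (rule joint_correct)
    show "?G (pair q p c) j t \<longleftrightarrow> (\<exists>u. ?K q j u \<and> transl\<^sub>2 p u t \<and> (c = None \<or> c = Some (h\<^sub>2 u)))" for q p c j t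
      using Node[of "ss ! j" q p c t] by (cases "j < length ss") auto
    show "u = u'" if "\<not> guessing" "?K q j u" "?K q j u'" for q j u u'
      using that transl_functional[OF guessing(2)] by blast
  qed
  have "transl (rules composite) (pair q p c) (Node a ss) t \<longleftrightarrow>
      (\<exists>r \<in> rules M\<^sub>1. rule_state r = q \<and> rule_sym r = a \<and> list_all2 (\<in>) ss (ranges r) \<and>
        p \<in> states M\<^sub>2 \<and> c \<in> constraints \<and>
        (\<exists>v. (c = None \<or> c = Some v) \<and> (\<exists>t'. joint (leaf_values ss) p (rhs r) v t' \<and> interp Node ?G t' t)))"
    (is "?L \<longleftrightarrow> ?R")
  proof
    assume ?L
    then obtain r ss' t' v where r: "r \<in> rules M\<^sub>1" "rule_state r = q" "rule_sym r = a"
      "p \<in> states M\<^sub>2" "c \<in> constraints"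
      and ss': "list_all2 (\<in>) ss' (ranges r)" "list_all2 (\<in>) ss (map profile_class ss')"
      and v: "joint (leaf_values ss') p (rhs r) v t'" "c = None \<or> c = Some v" and t: "interp Node ?G t' t"
      unfolding transl_Node_iff by (auto simp: composite_def)
    \<comment> \<open>The representatives \<open>ss'\<close> of the rule may differ from the actual
      subtrees \<open>ss\<close>; equal profiles allow the exchange.\<close>
    have eq: "map profile ss' = map profile ss" using ss'(2) map_profile_class_iff by metis
    show ?R
      using r ranges_cong[OF r(1) eq ss'(1)] v t unfolding leaf_values_cong[OF eq] by blast
  next
    assume ?R
    then obtain r v t' where r: "r \<in> rules M\<^sub>1" "rule_state r = q" "rule_sym r = a"
      "list_all2 (\<in>) ss (ranges r)" "p \<in> states M\<^sub>2" "c \<in> constraints"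
      and v: "joint (leaf_values ss) p (rhs r) v t'" "c = None \<or> c = Some v" and t: "interp Node ?G t' t"
      by blast
    have "Rule (pair q p c) a (map profile_class ss) t' \<in> rules composite"
      using r v by (auto simp: composite_def)
    moreover have "list_all2 (\<in>) ss (map profile_class ss)" by (simp add: map_profile_class_iff)
    ultimately show ?L
      unfolding transl_Node_iff using t by force
  qed
  also have "\<dots> \<longleftrightarrow> (\<exists>u. transl\<^sub>1 q (Node a ss) u \<and> transl\<^sub>2 p u t \<and> (c = None \<or> c = Some (h\<^sub>2 u)))"
  proof -
    have "c \<in> constraints" if "c = None \<or> c = Some (h\<^sub>2 u)" for u
      using that by (auto simp: constraints_def)
    then show ?thesis
      unfolding correct transl_Node_iff[of "rules M\<^sub>1"] using transl_state[OF M\<^sub>2] by blast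
  qed
  finally show ?case .
qed

lemma leaf_values_bounds:
  assumes "leaf_values ss q j v"
  shows "q \<in> states M\<^sub>1 \<and> j < length ss \<and> v \<in> range h\<^sub>2"
  using assms transl_state[OF M\<^sub>1] by (auto simp: leaf_values_def)

lemma finite_rules_composite: "finite (rules composite)"
proof -
  \<comment> \<open>Allowing every value in \<open>range h\<^sub>2\<close> at the leaves gives a
    finite bound independent of \<open>ss\<close>.\<close>
  let ?T = "\<lambda>r p. {(v, t). joint (\<lambda>q j v. v \<in> range h\<^sub>2) p (rhs r) v t}"
  let ?S = "\<lambda>r. {cs. set cs \<subseteq> range profile_class \<and> length cs = length (ranges r)}"
  have "profile_class s = (\<lambda>x. {s'. profile s' = x}) (profile s)" for s
    by (simp add: profile_class_def)
  then have "range profile_class \<subseteq> (\<lambda>x. {s'. profile s' = x}) ` range profile" by blast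
  then have "finite (range profile_class)"
    by (rule finite_subset)
      (use finite_congruence_profile in \<open>simp only: finite_congruence_def finite_imageI\<close>)
  then have S: "finite (?S r)" for r
    by (rule finite_lists_length_eq)
  have T: "finite (?T r p)" for r p
    using h\<^sub>2 by (intro finite_joint) (simp add: finite_congruence_def)
  let ?F = "\<Union>r \<in> rules M\<^sub>1. \<Union>p \<in> states M\<^sub>2. \<Union>c \<in> constraints. \<Union>cs \<in> ?S r.
    (\<lambda>(v, t). Rule (pair (rule_state r) p c) (rule_sym r) cs t) ` ?T r p"
  have "finite ?F"
  proof (intro finite_UN_I finite_constraints S finite_imageI T)
    show "finite (rules M\<^sub>1)" "finite (states M\<^sub>2)"
      using M\<^sub>1 M\<^sub>2 by (simp_all add: transducer_def)
  qed
  moreover have "rules composite \<subseteq> ?F"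
  proof
    fix R assume "R \<in> rules composite"
    then obtain r p c ss t v where R: "R = Rule (pair (rule_state r) p c) (rule_sym r) (map profile_class ss) t"
      "r \<in> rules M\<^sub>1" "p \<in> states M\<^sub>2" "c \<in> constraints" "list_all2 (\<in>) ss (ranges r)"
      "joint (leaf_values ss) p (rhs r) v t"
      by (rule composite_ruleE)
    have "joint (\<lambda>q j v. v \<in> range h\<^sub>2) p (rhs r) v t"
      using R(6) by (rule joint_mono) (simp add: leaf_values_bounds)
    then have "(v, t) \<in> ?T r p" by simp
    moreover have "map profile_class ss \<in> ?S r"
      using R(5) by (auto dest: list_all2_lengthD)
    ultimately have "R \<in> (\<lambda>(v, t). Rule (pair (rule_state r) p c) (rule_sym r) (map profile_class ss) t) ` ?T r p"
      unfolding R(1) by (intro image_eqI[of _ _ "(v, t)"]) simp_all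
    with \<open>map profile_class ss \<in> ?S r\<close> show "R \<in> ?F" using R(2-4) by blast
  qed
  ultimately show ?thesis by (rule finite_subset[rotated])
qed

lemma transducer_composite: "transducer composite"
proof -
  have "rule_of composite R" if R_rule: "R \<in> rules composite" for R
  proof -
    obtain r p c ss t v where R: "R = Rule (pair (rule_state r) p c) (rule_sym r) (map profile_class ss) t"
      "r \<in> rules M\<^sub>1" "p \<in> states M\<^sub>2" "c \<in> constraints" "list_all2 (\<in>) ss (ranges r)"
      "joint (leaf_values ss) p (rhs r) v t"
      using R_rule by (rule composite_ruleE)
    have len: "length ss = length (ranges r)" using R(5) by (rule list_all2_lengthD)
    have "recognizable (inputs M\<^sub>1) (profile_class s)" if s: "s \<in> set ss" for s
    proof (rule recognizable_if_saturates[OF finite_congruence_profile])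
      show "saturates profile (profile_class s)" by (simp add: saturates_def profile_class_def)
      obtain i where i: "i < length ss" "s = ss ! i"
        using s by (metis in_set_conv_nth)
      define L where "L = ranges r ! i"
      have L: "L \<in> set (ranges r)" "s \<in> L"
        using R(5) i len by (auto simp: L_def list_all2_conv_all_nth)
      \<comment> \<open>The class of \<open>s\<close> lies in a range of \<open>M\<^sub>1\<close>,
        hence contains input trees only, as recognizability demands.\<close>
      have "profile_class s \<subseteq> L"
      proof
        fix s' assume "s' \<in> profile_class s"
        then have "h\<^sub>1 s = h\<^sub>1 s'" by (simp add: profile_class_def profile_def)
        with L(2) show "s' \<in> L"
          using saturates\<^sub>1[OF R(2) L(1)] unfolding saturates_def by blast
      qed
      also have "L \<subseteq> trees (inputs M\<^sub>1)"
        using rules_transducerD(3)[OF M\<^sub>1 R(2) L(1)] by (auto simp: recognizable_def)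
      finally show "profile_class s \<subseteq> trees (inputs M\<^sub>1)" .
    qed
    moreover have "t \<in> trees_over (embed_ranked (outputs M\<^sub>2))
        {Node (State q) [var i] | q i. q \<in> composite_states \<and> i < length ss}"
      using R(6,3) leaf_values_bounds by (rule joint_rhs)
    ultimately show ?thesis
      using R(1-4) rules_transducerD(1,2)[OF M\<^sub>1 R(2)] len
      by (auto simp: rule_of_def composite_def composite_states_def)
  qed
  moreover have "finite composite_states"
    using M\<^sub>1 M\<^sub>2 finite_constraints by (simp add: composite_states_def transducer_def)
  moreover have "initial composite \<subseteq> composite_states"
    using M\<^sub>1 M\<^sub>2 by (auto simp: composite_def composite_states_def constraints_def transducer_def)
  ultimately show ?thesis
    using M\<^sub>1 M\<^sub>2 finite_rules_composite by (simp add: transducer_def composite_def)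
qed

lemma composite_initial: "initial composite = (\<Union>q \<in> initial M\<^sub>1. \<Union>p \<in> initial M\<^sub>2. {pair q p None})"
  by (auto simp: composite_def)

lemma realized_composite: "realized composite = realized M\<^sub>1 O realized M\<^sub>2"
proof -
  have "(s, t) \<in> realized composite \<longleftrightarrow> (s, t) \<in> realized M\<^sub>1 O realized M\<^sub>2" for s t
    unfolding realized_iff_transl[OF transducer_composite] relcomp_unfold mem_Collect_eq
      case_prod_conv realized_iff_transl[OF M\<^sub>1] realized_iff_transl[OF M\<^sub>2]
    by (auto simp: composite_initial transl_composite)
  then show ?thesis by auto
qed

text \<open>If no position separates two rules with one left-hand side, their profile tuples agree.
  Determinism of \<open>M\<^sub>1\<close> then gives the same underlying rule, and
  \<open>joint_functional\<close> the same right-hand side.\<close>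

lemma deterministic_composite:
  assumes "\<not> guessing" "deterministic M\<^sub>2"
  shows "deterministic composite"
  unfolding deterministic_def
proof (intro conjI ballI impI)
  note det\<^sub>1 = guessing(2)[OF assms(1)]
  obtain q p where "initial M\<^sub>1 = {q}" "initial M\<^sub>2 = {p}"
    using det\<^sub>1 assms(2) by (auto simp: deterministic_def)
  then show "\<exists>q. initial composite = {q}"
    by (auto simp: composite_def)
  fix R R' assume in_rules: "R \<in> rules composite" "R' \<in> rules composite"
    and neq: "R \<noteq> R' \<and> lhs R = lhs R'"
  obtain r p c ss t v where
    R: "R = Rule (pair (rule_state r) p c) (rule_sym r) (map profile_class ss) t"
      "r \<in> rules M\<^sub>1" "list_all2 (\<in>) ss (ranges r)" "joint (leaf_values ss) p (rhs r) v t"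
    using in_rules(1) by (rule composite_ruleE)
  obtain r' p' c' ss' t' v' where
    R': "R' = Rule (pair (rule_state r') p' c') (rule_sym r') (map profile_class ss') t'"
      "r' \<in> rules M\<^sub>1" "list_all2 (\<in>) ss' (ranges r')" "joint (leaf_values ss') p' (rhs r') v' t'"
    using in_rules(2) by (rule composite_ruleE)
  have "map var [0..<length ss] = (map var [0..<length ss'] :: ('a, nat) sym tree list)"
    using neq by (simp add: lhs_def R(1) R'(1))
  then have len: "length ss = length ss'"
    by (metis length_map length_upt minus_nat.diff_0)
  have same: "rule_state r = rule_state r'" "rule_sym r = rule_sym r'" "p = p'" "c = c'"
    using neq by (auto simp: lhs_def R(1) R'(1))
  show "\<exists>i < length (ranges R). ranges R ! i \<inter> ranges R' ! i = {}"
  proof (rule ccontr)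
    assume "\<not> ?thesis"
    then have "profile (ss ! i) = profile (ss' ! i)" if "i < length ss" for i
      using that len by (auto simp: R(1) R'(1) profile_class_def)
    then have eq: "map profile ss = map profile ss'"
      using len by (auto intro: nth_equalityI)
    have ss': "list_all2 (\<in>) ss' (ranges r)"
      using ranges_cong[OF R(2) eq R(3)] .
    have "r = r'"
    proof (rule deterministicD[OF det\<^sub>1 R(2) R'(2) same(1,2)])
      show "length (ranges r) = length (ranges r')"
        using list_all2_lengthD[OF ss'] list_all2_lengthD[OF R'(3)] by simp
      show "\<exists>s. s \<in> ranges r ! i \<and> s \<in> ranges r' ! i" if "i < length (ranges r)" for i
        using ss' R'(3) that by (intro exI[of _ "ss' ! i"]) (auto simp: list_all2_conv_all_nth)
    qed
    have "w = w'" if "leaf_values ss q j w" "leaf_values ss q j w'" for q j w w'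
      using that transl_functional[OF det\<^sub>1] by (auto simp: leaf_values_def)
    then have "t = t'"
      using joint_functional[OF assms(2) _ R(4)] R'(4)
      unfolding leaf_values_cong[OF eq[symmetric]] \<open>r = r'\<close>[symmetric] same(3)[symmetric] by blast
    moreover have "map profile_class ss = map profile_class ss'"
      using eq unfolding profile_class_def list_eq_iff_nth_eq by simp
    ultimately show False
      using neq same by (simp add: R(1) R'(1))
  qed
qed

end

section \<open>Closure of the classes under composition\<close>

lemma composite_exists:
  fixes M\<^sub>1 M\<^sub>2 :: "('a, nat) transducer"
  assumes "transducer M\<^sub>1" "transducer M\<^sub>2" "linear M\<^sub>2 \<or> deterministic M\<^sub>1"
  shows "\<exists>M :: ('a, nat) transducer. transducer M \<and> realized M = realized M\<^sub>1 O realized M\<^sub>2 \<and>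
    (deterministic M\<^sub>1 \<and> deterministic M\<^sub>2 \<longrightarrow> deterministic M)"
proof -
  obtain h\<^sub>1 :: "'a tree \<Rightarrow> nat" where h\<^sub>1: "finite_congruence h\<^sub>1"
    "\<And>r L. r \<in> rules M\<^sub>1 \<Longrightarrow> L \<in> set (ranges r) \<Longrightarrow> saturates h\<^sub>1 L"
    using transducer_congruence[OF assms(1)] by blast
  obtain h\<^sub>2 :: "'a tree \<Rightarrow> nat" where h\<^sub>2: "finite_congruence h\<^sub>2"
    "\<And>r L. r \<in> rules M\<^sub>2 \<Longrightarrow> L \<in> set (ranges r) \<Longrightarrow> saturates h\<^sub>2 L"
    using transducer_congruence[OF assms(2)] by blast
  obtain \<delta> where \<delta>: "\<And>a us. h\<^sub>2 (Node a us) = \<delta> a (map h\<^sub>2 us)"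
    using finite_congruence_transition[OF h\<^sub>2(1)] by blast
  \<comment> \<open>Guessing only when \<open>M\<^sub>1\<close> is not deterministic keeps the
    composite of deterministic transducers deterministic, even if \<open>M\<^sub>2\<close> is also
    linear.\<close>
  interpret composition M\<^sub>1 M\<^sub>2 h\<^sub>1 h\<^sub>2 \<delta> "\<not> deterministic M\<^sub>1"
    using assms h\<^sub>1 h\<^sub>2 \<delta> by unfold_locales auto
  show ?thesis
    using transducer_composite realized_composite deterministic_composite by blast
qed

theorem theorem4p81:
  "(T' :: 'a transformation set) \<circ>\<^sub>c LT' \<subseteq> T' \<and>
   (DT' :: 'a transformation set) \<circ>\<^sub>c T' \<subseteq> T' \<and>
   (DT' :: 'a transformation set) \<circ>\<^sub>c DT' \<subseteq> DT'"
proof (intro conjI subsetI)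
  fix X :: "'a transformation"
  show "X \<in> T'" if "X \<in> T' \<circ>\<^sub>c LT'"
  proof -
    from that obtain M\<^sub>1 M\<^sub>2 :: "('a, nat) transducer" where
      M: "transducer M\<^sub>1" "transducer M\<^sub>2" "linear M\<^sub>2" and X: "X = realized M\<^sub>1 O realized M\<^sub>2"
      unfolding class_comp_def T'_def LT'_def by blast
    from M obtain M :: "('a, nat) transducer" where "transducer M" "realized M = X"
      using composite_exists[of M\<^sub>1 M\<^sub>2] unfolding X by blast
    then show ?thesis unfolding T'_def by blast
  qed
  show "X \<in> T'" if "X \<in> DT' \<circ>\<^sub>c T'"
  proof -
    from that obtain M\<^sub>1 M\<^sub>2 :: "('a, nat) transducer" where
      M: "transducer M\<^sub>1" "transducer M\<^sub>2" "deterministic M\<^sub>1" and X: "X = realized M\<^sub>1 O realized M\<^sub>2"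
      unfolding class_comp_def T'_def DT'_def by blast
    from M obtain M :: "('a, nat) transducer" where "transducer M" "realized M = X"
      using composite_exists[of M\<^sub>1 M\<^sub>2] unfolding X by blast
    then show ?thesis unfolding T'_def by blast
  qed
  show "X \<in> DT'" if "X \<in> DT' \<circ>\<^sub>c DT'"
  proof -
    from that obtain M\<^sub>1 M\<^sub>2 :: "('a, nat) transducer" where
      M: "transducer M\<^sub>1" "transducer M\<^sub>2" "deterministic M\<^sub>1" "deterministic M\<^sub>2"
      and X: "X = realized M\<^sub>1 O realized M\<^sub>2"
      unfolding class_comp_def DT'_def by blast
    from M obtain M :: "('a, nat) transducer" where "transducer M" "realized M = X" "deterministic M"
      using composite_exists[of M\<^sub>1 M\<^sub>2] unfolding X by blast
    then show ?thesis unfolding DT'_def by blast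
  qed
qed

end
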